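(* Let $r\geq 3$, let $\mathcal{G}$ and $\mathcal{H}$ be $r$-uniform supertrees with the same number of vertices, let $u\in V(\mathcal{G})$, $v\in V(\mathcal{H})$, and let $m$ be a positive integer. If $\varphi(\mathcal{G},x)=\varphi(\mathcal{H},x)$ and $\varphi(\mathcal{G}-u,x)=\varphi(\mathcal{H}-v,x)$, then (i) $\rho(\mathcal{H}_v^m)=\rho(\mathcal{H}_v^{m-1}\cdot\mathcal{G}_u)=\rho(\mathcal{H}_v^{m-2}\cdot\mathcal{G}_u^2)=\cdots=\rho(\mathcal{H}_v\cdot\mathcal{G}_u^{m-1})=\rho(\mathcal{G}_u^m)$; (ii) $ME(\mathcal{H}_v^m)=ME(\mathcal{H}_v^{m-1}\cdot\mathcal{G}_u)=ME(\mathcal{H}_v^{m-2}\cdot\mathcal{G}_u^2)=\cdots=ME(\mathcal{H}_v\cdot\mathcal{G}_u^{m-1})=ME(\mathcal{G}_u^m)$.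
   Context: An $r$-uniform supertree is a connected acyclic hypergraph each of whose edges has exactly $r$ vertices. For an $r$-uniform hypergraph $\mathcal{H}$ on $n$ vertices, $m(\mathcal{H},k)$ is the number of sets of $k$ pairwise disjoint edges ($m(\mathcal{H},0)=1$), and $\varphi(\mathcal{H},x)=\sum_{k\geq 0}(-1)^k m(\mathcal{H},k)x^{n-kr}$ is the matching polynomial. $ME(\mathcal{H})$ is the sum of the absolute values of all roots (with multiplicity) of $\varphi(\mathcal{H},x)$. The adjacency tensor of $\mathcal{H}$ on $[n]$ has entries $a_{i_1\cdots i_r}=1/(r-1)!$ if $\{i_1,\dots,i_r\}$ is an edge and $0$ otherwise; $\lambda$ is an eigenvalue if some nonzero $x\in\mathbb{C}^n$ satisfies $\sum_{i_2,\dots,i_r}a_{ii_2\cdots i_r}x_{i_2}\cdots x_{i_r}=\lambda x_i^{r-1}$ for all $i$; $\rho(\mathcal{H})$ is the maximum modulus of the eigenvalues. $\mathcal{H}-v$ deletes vertex $v$ and all edges containing it. For $k\geq 1$, $\mathcal{G}_u^k$ is the hypergraph obtained from $k$ disjoint copies of $\mathcal{G}$ by identifying the copies of $u$ into one common vertex (so $\mathcal{G}_u^1=\mathcal{G}$), and similarly $\mathcal{H}_v^k$; $\mathcal{H}_v^{a}\cdot\mathcal{G}_u^{b}$ is obtained from $\mathcal{H}_v^a$ and $\mathcal{G}_u^b$ by identifying the common vertex $v$ of the former with the common vertex $u$ of the latter. *)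

theory Defs
  imports Complex_Main "HOL-Computational_Algebra.Polynomial"
begin

text \<open>A hypergraph is a pair (vertex set, edge set).\<close>
type_synonym 'a hypergraph = "'a set \<times> 'a set set"

definition verts :: "'a hypergraph \<Rightarrow> 'a set" where "verts H = fst H"
definition edges :: "'a hypergraph \<Rightarrow> 'a set set" where "edges H = snd H"

definition uniform :: "nat \<Rightarrow> 'a hypergraph \<Rightarrow> bool" where
  "uniform r H \<longleftrightarrow> finite (verts H) \<and> (\<forall>e\<in>edges H. e \<subseteq> verts H \<and> card e = r)"

definition adjacent_rel :: "'a hypergraph \<Rightarrow> ('a \<times> 'a) set" where
  "adjacent_rel H = {(x, y). \<exists>e\<in>edges H. x \<in> e \<and> y \<in> e}"

definition connected_hg :: "'a hypergraph \<Rightarrow> bool" where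
  "connected_hg H \<longleftrightarrow> (\<forall>x\<in>verts H. \<forall>y\<in>verts H. (x, y) \<in> (adjacent_rel H)\<^sup>*)"

text \<open>Berge cycle v_0 e_0 v_1 e_1 ... v_(k-1) e_(k-1) v_0 with k >= 2,
  distinct vertices, distinct edges, v_i, v_(i+1 mod k) in e_i.\<close>
definition berge_cycle :: "'a hypergraph \<Rightarrow> 'a list \<Rightarrow> 'a set list \<Rightarrow> bool" where
  "berge_cycle H vs es \<longleftrightarrow> length vs \<ge> 2 \<and> length es = length vs \<and>
     distinct vs \<and> distinct es \<and> set es \<subseteq> edges H \<and>
     (\<forall>i < length vs. vs ! i \<in> es ! i \<and> vs ! ((i + 1) mod length vs) \<in> es ! i)"

definition acyclic_hg :: "'a hypergraph \<Rightarrow> bool" where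
  "acyclic_hg H \<longleftrightarrow> \<not> (\<exists>vs es. berge_cycle H vs es)"

definition supertree :: "nat \<Rightarrow> 'a hypergraph \<Rightarrow> bool" where
  "supertree r H \<longleftrightarrow> uniform r H \<and> connected_hg H \<and> acyclic_hg H"

text \<open>Deleting a vertex and all edges containing it.\<close>
definition delete_vertex :: "'a hypergraph \<Rightarrow> 'a \<Rightarrow> 'a hypergraph" where
  "delete_vertex H v = (verts H - {v}, {e \<in> edges H. v \<notin> e})"

definition matchings :: "'a hypergraph \<Rightarrow> nat \<Rightarrow> 'a set set set" where
  "matchings H k = {M. M \<subseteq> edges H \<and> card M = k \<and> pairwise disjnt M}"

definition match_count :: "'a hypergraph \<Rightarrow> nat \<Rightarrow> nat" where
  "match_count H k = card (matchings H k)"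

text \<open>Matching polynomial; terms with k r > n vanish since then m(H,k) = 0.\<close>
definition matching_poly :: "nat \<Rightarrow> 'a hypergraph \<Rightarrow> real poly" where
  "matching_poly r H = (\<Sum>k\<in>{0..card (edges H)}.
      monom ((-1) ^ k * real (match_count H k)) (card (verts H) - k * r))"

text \<open>Matching energy: sum of absolute values of all (complex) roots, with multiplicity.\<close>
definition matching_energy :: "nat \<Rightarrow> 'a hypergraph \<Rightarrow> real" where
  "matching_energy r H = (let p = map_poly complex_of_real (matching_poly r H) in
      \<Sum>z\<in>{z. poly p z = 0}. real (order z p) * cmod z)"

text \<open>Adjacency tensor entry a_{i_1...i_r}, indices given as a list.\<close>
definition adj_tensor :: "nat \<Rightarrow> 'a hypergraph \<Rightarrow> 'a list \<Rightarrow> complex" where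
  "adj_tensor r H js = (if length js = r \<and> set js \<in> edges H then 1 / of_nat (fact (r - 1)) else 0)"

definition tensor_eigenvalue :: "nat \<Rightarrow> 'a hypergraph \<Rightarrow> complex \<Rightarrow> bool" where
  "tensor_eigenvalue r H lam \<longleftrightarrow> (\<exists>x :: 'a \<Rightarrow> complex. (\<exists>i\<in>verts H. x i \<noteq> 0) \<and>
     (\<forall>i\<in>verts H.
        (\<Sum>js\<in>{js. length js = r - 1 \<and> set js \<subseteq> verts H}.
            adj_tensor r H (i # js) * prod_list (map x js)) = lam * x i ^ (r - 1)))"

definition spectral_radius_hg :: "nat \<Rightarrow> 'a hypergraph \<Rightarrow> real" where
  "spectral_radius_hg r H = Sup (cmod ` {lam. tensor_eigenvalue r H lam})"

text \<open>H_v^a . G_u^b: a copies of H and b copies of G, all copies of v and u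
  identified into the single common vertex None.\<close>
definition coalesce ::
  "'a hypergraph \<Rightarrow> 'a \<Rightarrow> nat \<Rightarrow> 'b hypergraph \<Rightarrow> 'b \<Rightarrow> nat \<Rightarrow> ((nat \<times> 'a) + (nat \<times> 'b)) option hypergraph" where
  "coalesce H v a G u b =
     (insert None
        ({Some (Inl (i, w)) | i w. i < a \<and> w \<in> verts H - {v}} \<union>
         {Some (Inr (j, w)) | j w. j < b \<and> w \<in> verts G - {u}}),
      {(\<lambda>w. if w = v then None else Some (Inl (i, w))) ` e | i e. i < a \<and> e \<in> edges H} \<union>
      {(\<lambda>w. if w = u then None else Some (Inr (j, w))) ` e | j e. j < b \<and> e \<in> edges G})"

end

theory Submission
  imports Defs "HOL-Combinatorics.Multiset_Permutations"
begin

text \<open>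
  Write \<open>\<psi>(U)\<close> for the matching polynomial of the subhypergraph induced on \<open>U\<close>. Gluing copies of
  rooted hypergraphs at their roots yields a matching polynomial that depends only on the number of
  copies and on the polynomials of a copy with and without its root. This settles (ii), and (i)
  follows since the spectral radius of a hypertree is the largest real root \<open>t\<close> of its matching
  polynomial.

  For the latter, removing an edge \<open>e\<close> splits the hypertree into components \<open>C\<^sub>w\<close> with \<open>w \<in> e\<close>. With
  \<open>A\<^sub>w = \<psi>(C\<^sub>w)\<close> and \<open>B\<^sub>w = \<psi>(C\<^sub>w - w)\<close> we have \<open>\<psi>(V) = \<Prod>A\<^sub>w - \<Prod>B\<^sub>w\<close>, \<open>\<psi>(V - e) = \<Prod>B\<^sub>w\<close> and
  \<open>\<psi>(V - p) = B\<^sub>p \<Prod>\<^sub>w\<^sub>\<noteq>\<^sub>p A\<^sub>w\<close>. All \<open>\<psi>(U)\<close> are nonnegative at \<open>t\<close>, so induction on components gives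
  \<open>\<psi>(V - p) > 0\<close> at \<open>t\<close>. Put \<open>x\<^sub>w = \<psi>(V - w)\<^sup>1\<^sup>/\<^sup>r\<close>. As \<open>\<psi>(V)\<close> vanishes at \<open>t\<close>, the product of \<open>x\<^sub>w\<close>
  over an edge \<open>e\<close> is \<open>\<psi>(V - e)\<close>, and the vertex recursion of the matching polynomial becomes the
  eigenvalue equation for the positive vector \<open>x\<close>, whose eigenvalue \<open>t\<close> bounds all others.
\<close>

section \<open>Hypergraphs as pairs and induced subhypergraphs\<close>

lemma verts_pair [simp]: "verts (V, E) = V"
  by (simp add: verts_def)

lemma edges_pair [simp]: "edges (V, E) = E"
  by (simp add: edges_def)

lemma uniform_pair:
  "uniform r (V, E) \<longleftrightarrow> finite V \<and> (\<forall>e\<in>E. e \<subseteq> V \<and> card e = r)"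
  by (simp add: uniform_def)

lemma uniform_finite_edges: "uniform r (V, E) \<Longrightarrow> finite E"
  unfolding uniform_pair by (rule finite_subset[of _ "Pow V"]) auto

text \<open>With the edge set fixed and only the vertex set varying, deleting a vertex, deleting all
  vertices of an edge and passing to a component all take the same form.\<close>

definition induced :: "'a set set \<Rightarrow> 'a set \<Rightarrow> 'a hypergraph" where
  "induced E U = (U, {e \<in> E. e \<subseteq> U})"

lemma uniform_induced: "uniform r (V, E) \<Longrightarrow> U \<subseteq> V \<Longrightarrow> uniform r (induced E U)"
  unfolding induced_def uniform_pair by (auto intro: finite_subset)

lemma induced_self: "uniform r (V, E) \<Longrightarrow> induced E V = (V, E)"
  unfolding induced_def uniform_pair by auto

lemma delete_vertex_eq_induced:
  "uniform r (V, E) \<Longrightarrow> delete_vertex (V, E) v = induced E (V - {v})"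
  unfolding induced_def uniform_pair delete_vertex_def by auto

section \<open>Matching polynomials\<close>

lemma finite_matchings: "finite E \<Longrightarrow> finite {M. M \<subseteq> E \<and> pairwise disjnt M}"
  by (rule finite_subset[of _ "Pow E"]) auto

text \<open>Summing over the matchings themselves instead of over their sizes turns the identities
  below into bijections between sets of matchings.\<close>

lemma matching_poly_eq_sum:
  assumes "finite E"
  shows "matching_poly r (V, E) =
    (\<Sum>M | M \<subseteq> E \<and> pairwise disjnt M. monom ((-1) ^ card M) (card V - card M * r))"
proof -
  let ?S = "{M. M \<subseteq> E \<and> pairwise disjnt M}"
  let ?h = "\<lambda>M. monom ((-1) ^ card M :: real) (card V - card M * r)"
  have fin: "finite ?S"
    using assms by (rule finite_matchings)
  have "sum ?h ?S = (\<Sum>k\<in>{0..card E}. sum ?h {M \<in> ?S. card M = k})"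
    by (rule sum.group[symmetric]) (use fin assms card_mono in auto)
  also have "\<dots> = (\<Sum>k\<in>{0..card E}.
      monom ((-1) ^ k * real (match_count (V, E) k)) (card V - k * r))"
  proof (rule sum.cong[OF refl])
    fix k
    have eq: "{M \<in> ?S. card M = k} = matchings (V, E) k"
      by (auto simp: matchings_def)
    have "sum ?h {M \<in> ?S. card M = k} =
        (\<Sum>M\<in>{M \<in> ?S. card M = k}. monom ((-1) ^ k) (card V - k * r))"
      by (rule sum.cong) auto
    then show "sum ?h {M \<in> ?S. card M = k} =
        monom ((-1) ^ k * real (match_count (V, E) k)) (card V - k * r)"
      unfolding eq match_count_def by (simp add: of_nat_poly smult_monom mult.commute)
  qed
  finally show ?thesis
    by (simp add: matching_poly_def)
qed

text \<open>Guarantees that the truncated subtraction in the exponent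
  \<open>card V - card M * r\<close> is a genuine one.\<close>

lemma matching_size_bound:
  assumes "uniform r (V, E)" "M \<subseteq> E" "pairwise disjnt M"
  shows "card M * r \<le> card V"
proof -
  have fin: "finite V" and E: "\<forall>e\<in>E. e \<subseteq> V \<and> card e = r"
    using assms(1) by (auto simp: uniform_pair)
  have "card (\<Union>M) = sum card M"
    by (rule card_Union_disjoint) (use assms E fin in \<open>auto intro: finite_subset\<close>)
  also have "\<dots> = card M * r"
    using assms(2) E by (subst sum.cong[OF refl, of M card "\<lambda>_. r"]) auto
  finally show ?thesis
    using card_mono[OF fin, of "\<Union>M"] assms(2) E by auto
qed

lemma matching_poly_empty_edges: "matching_poly r (V, {}) = monom 1 (card V)"
proof -
  have "{M. M \<subseteq> {} \<and> pairwise disjnt M} = {{}::'a set set}"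
    by auto
  then show ?thesis
    by (simp add: matching_poly_eq_sum)
qed

text \<open>Only the empty matching reaches degree \<open>card V\<close>. Monicity later gives
  finiteness of the root set and positivity far to the right.\<close>

lemma matching_poly_monic:
  assumes "uniform r (V, E)" "r > 0"
  shows "lead_coeff (matching_poly r (V, E)) = 1"
proof -
  let ?p = "matching_poly r (V, E)"
  let ?S = "{M. M \<subseteq> E \<and> pairwise disjnt M}"
  have fin: "finite E"
    using assms(1) by (rule uniform_finite_edges)
  have "coeff ?p (card V) = (\<Sum>M\<in>?S. if M = {} then 1 else 0)"
    unfolding matching_poly_eq_sum[OF fin] coeff_sum
  proof (rule sum.cong[OF refl])
    fix M assume M: "M \<in> ?S"
    then have "finite M"
      using fin finite_subset by auto
    moreover have "card M * r \<le> card V"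
      using matching_size_bound[OF assms(1)] M by auto
    ultimately have "card V - card M * r \<noteq> card V" if "M \<noteq> {}"
      using that assms(2) by (cases "card M * r") auto
    then show "coeff (monom ((-1) ^ card M) (card V - card M * r)) (card V) = (if M = {} then 1 else 0 :: real)"
      by (cases "M = {}") auto
  qed
  also have "\<dots> = 1"
    using finite_matchings[OF fin] by (subst sum.delta) auto
  finally have c: "coeff ?p (card V) = 1" .
  have "degree ?p \<le> card V"
    unfolding matching_poly_eq_sum[OF fin]
    by (rule degree_sum_le[OF finite_matchings[OF fin]]) (rule order_trans[OF degree_monom_le], simp)
  moreover have "card V \<le> degree ?p"
    using c by (intro le_degree) simp
  ultimately show ?thesis
    using c by simp
qed

text \<open>A matching of the union splits uniquely into its traces on \<open>E1\<close> and
  \<open>E2\<close>. Positivity of \<open>r\<close> rules out the empty edge, the only one that both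
  sides could share.\<close>

lemma matching_poly_disjoint_Un:
  assumes U1: "uniform r (V1, E1)" and U2: "uniform r (V2, E2)"
    and "V1 \<inter> V2 = {}" and "r > 0"
  shows "matching_poly r (V1 \<union> V2, E1 \<union> E2) = matching_poly r (V1, E1) * matching_poly r (V2, E2)"
proof -
  have fin: "finite E1" "finite E2" "finite V1" "finite V2"
    using uniform_finite_edges[OF U1] uniform_finite_edges[OF U2] U1 U2 by (auto simp: uniform_pair)
  have sub: "e \<subseteq> V1" "e \<noteq> {}" if "e \<in> E1" for e
    using U1 that \<open>r > 0\<close> by (auto simp: uniform_pair)
  have sub': "e \<subseteq> V2" "e \<noteq> {}" if "e \<in> E2" for e
    using U2 that \<open>r > 0\<close> by (auto simp: uniform_pair)
  have dis: "E1 \<inter> E2 = {}"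
  proof (rule ccontr)
    assume "E1 \<inter> E2 \<noteq> {}"
    then obtain e where "e \<in> E1" "e \<in> E2"
      by auto
    then show False
      using sub(1)[of e] sub'(1)[of e] sub(2)[of e] assms(3) by auto
  qed
  let ?S = "\<lambda>E. {M. M \<subseteq> E \<and> pairwise disjnt M}"
  let ?h = "\<lambda>V M. monom ((-1) ^ card M :: real) (card V - card M * r)"
  have pw: "pairwise disjnt (M1 \<union> M2)"
    if "M1 \<in> ?S E1" "M2 \<in> ?S E2" for M1 M2
  proof -
    have "disjnt e f" "disjnt f e" if "e \<in> M1" "f \<in> M2" for e f
    proof -
      have "e \<subseteq> V1" "f \<subseteq> V2"
        using that \<open>M1 \<in> ?S E1\<close> \<open>M2 \<in> ?S E2\<close> sub(1)[of e] sub'(1)[of f] by auto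
      then show "disjnt e f" "disjnt f e"
        using assms(3) by (auto simp: disjnt_def)
    qed
    then show ?thesis
      using that by (auto simp: pairwise_def)
  qed
  have "matching_poly r (V1, E1) * matching_poly r (V2, E2) =
      (\<Sum>(M1, M2)\<in>?S E1 \<times> ?S E2. ?h V1 M1 * ?h V2 M2)"
    using fin by (simp add: matching_poly_eq_sum sum_product sum.cartesian_product)
  also have "\<dots> = (\<Sum>M\<in>?S (E1 \<union> E2). ?h (V1 \<union> V2) M)"
  proof (rule sum.reindex_bij_witness[of _ "\<lambda>M. (M \<inter> E1, M \<inter> E2)" "\<lambda>(M1, M2). M1 \<union> M2"], goal_cases)
    case (1 a)
    then show ?case using dis by auto
  next
    case (2 a)
    then show ?case using pw by auto
  next
    case (3 b)
    then show ?case by auto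
  next
    case (4 b)
    then show ?case by (auto intro: pairwise_subset)
  next
    case (5 a)
    then obtain M1 M2 where a: "a = (M1, M2)" "M1 \<in> ?S E1" "M2 \<in> ?S E2"
      by auto
    \<comment> \<open>Exponents add up only because neither of the two truncated differences is cut
      off.\<close>
    have "card M1 * r \<le> card V1" "card M2 * r \<le> card V2"
      using a matching_size_bound[OF U1] matching_size_bound[OF U2] by auto
    moreover have "card (M1 \<union> M2) = card M1 + card M2"
      using a dis fin by (intro card_Un_disjoint) (auto intro: finite_subset)
    moreover have "card (V1 \<union> V2) = card V1 + card V2"
      using fin assms(3) by (intro card_Un_disjoint)
    ultimately show ?case
      using a by (simp add: mult_monom power_add add_mult_distrib add.commute)
  qed
  also have "\<dots> = matching_poly r (V1 \<union> V2, E1 \<union> E2)"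
    using fin by (simp add: matching_poly_eq_sum)
  finally show ?thesis ..
qed

text \<open>Matchings through \<open>e\<close> correspond to matchings avoiding all vertices of
  \<open>e\<close>; dropping \<open>e\<close> lowers the size by one and so flips the sign.\<close>

lemma matching_poly_delete_edge:
  assumes U: "uniform r (V, E)" and e: "e \<in> E" and "r > 0"
  shows "matching_poly r (V, E) =
    matching_poly r (V, E - {e}) - matching_poly r (induced E (V - e))"
proof -
  have fin: "finite E" "finite V" and sub: "e \<subseteq> V" "card e = r" "e \<noteq> {}"
    using uniform_finite_edges[OF U] U e \<open>r > 0\<close> by (auto simp: uniform_pair)
  have Esub: "f \<subseteq> V" if "f \<in> E" for f
    using U that by (auto simp: uniform_pair)
  let ?E' = "{f \<in> E. f \<subseteq> V - e}"
  let ?S = "\<lambda>E. {M. M \<subseteq> E \<and> pairwise disjnt M}"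
  let ?h = "\<lambda>V M. monom ((-1) ^ card M :: real) (card V - card M * r)"
  have eE': "e \<notin> ?E'"
    using sub by auto
  have split: "?S E = ?S (E - {e}) \<union> insert e ` ?S ?E'" (is "?L = ?R")
  proof (intro equalityI subsetI)
    fix M assume M: "M \<in> ?L"
    show "M \<in> ?R"
    proof (cases "e \<in> M")
      case True
      then have "M = insert e (M - {e})"
        by auto
      moreover have "M - {e} \<in> ?S ?E'"
        using M True Esub unfolding pairwise_def disjnt_def by blast
      ultimately show ?thesis
        by blast
    qed (use M in auto)
  next
    fix M assume "M \<in> ?R"
    then show "M \<in> ?L"
    proof
      assume "M \<in> insert e ` ?S ?E'"
      then show ?thesis
        using e unfolding pairwise_def disjnt_def by blast
    qed auto
  qed
  have "matching_poly r (V, E) = sum (?h V) (?S (E - {e})) + sum (?h V) (insert e ` ?S ?E')"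
    unfolding matching_poly_eq_sum[OF fin(1)] split
    by (rule sum.union_disjoint) (use fin finite_matchings in auto)
  also have "sum (?h V) (insert e ` ?S ?E') = (\<Sum>M\<in>?S ?E'. ?h V (insert e M))"
  proof (subst sum.reindex)
    have "e \<notin> M" if "M \<in> ?S ?E'" for M
      using that eE' by auto
    then show "inj_on (insert e) (?S ?E')"
      by (intro inj_onI) (metis insert_ident)
  qed (simp add: o_def)
  also have "\<dots> = - (\<Sum>M\<in>?S ?E'. ?h (V - e) M)"
    unfolding sum_negf[symmetric]
  proof (rule sum.cong[OF refl])
    fix M assume M: "M \<in> ?S ?E'"
    then have "finite M" "e \<notin> M"
      using fin eE' finite_subset[of M E] by auto
    then have "card (insert e M) = Suc (card M)"
      by simp
    moreover have "card (V - e) = card V - r"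
      using sub fin finite_subset by (subst card_Diff_subset) auto
    ultimately show "?h V (insert e M) = - ?h (V - e) M"
      by (simp add: minus_monom)
  qed
  finally show ?thesis
    using fin by (simp add: matching_poly_eq_sum induced_def)
qed

lemma matching_poly_isolated_vertex:
  assumes "uniform r (V, E)" "v \<in> V" "\<forall>e\<in>E. v \<notin> e" "r > 0"
  shows "matching_poly r (V, E) = [:0, 1:] * matching_poly r (V - {v}, E)"
proof -
  have "matching_poly r ({v} \<union> (V - {v}), {} \<union> E) =
      matching_poly r ({v}, {}) * matching_poly r (V - {v}, E)"
    by (rule matching_poly_disjoint_Un) (use assms in \<open>auto simp: uniform_pair\<close>)
  moreover have "{v} \<union> (V - {v}) = V"
    using assms(2) by auto
  ultimately show ?thesis
    by (simp add: matching_poly_empty_edges monom_altdef)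
qed

text \<open>The edges at \<open>v\<close> are deleted one at a time until \<open>v\<close> is
  isolated and contributes a factor \<open>x\<close>.\<close>

lemma matching_poly_vertex_recursion:
  assumes U: "uniform r (V, E)" and v: "v \<in> V" and "r > 0"
  shows "matching_poly r (V, E) = [:0, 1:] * matching_poly r (induced E (V - {v})) -
    (\<Sum>e | e \<in> E \<and> v \<in> e. matching_poly r (induced E (V - e)))"
proof -
  have fin: "finite E"
    using U by (rule uniform_finite_edges)
  have Esub: "f \<subseteq> V" if "f \<in> E" for f
    using U that by (auto simp: uniform_pair)
  have *: "matching_poly r (V, E) = matching_poly r (V, E - F) -
      (\<Sum>e\<in>F. matching_poly r (induced E (V - e)))"
    if "finite F" "F \<subseteq> {e \<in> E. v \<in> e}" for F
    using that
  proof (induction F rule: finite_induct)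
    case (insert e F)
    have "matching_poly r (V, E - F) = matching_poly r (V, E - F - {e}) -
        matching_poly r (induced (E - F) (V - e))"
      by (rule matching_poly_delete_edge) (use insert U \<open>r > 0\<close> in \<open>auto simp: uniform_pair\<close>)
    \<comment> \<open>Edges in \<open>F\<close> contain \<open>v\<close>, which is gone from
      \<open>V - e\<close>; the earlier deletions are therefore invisible there.\<close>
    moreover have "induced (E - F) (V - e) = induced E (V - e)"
      using insert.prems unfolding induced_def by blast
    moreover have "E - F - {e} = E - insert e F"
      by auto
    ultimately show ?case
      using insert by simp
  qed simp
  let ?F = "{e \<in> E. v \<in> e}"
  have "matching_poly r (V, E - ?F) = [:0, 1:] * matching_poly r (V - {v}, E - ?F)"
    by (rule matching_poly_isolated_vertex) (use U v \<open>r > 0\<close> in \<open>auto simp: uniform_pair\<close>)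
  moreover have "(V - {v}, E - ?F) = induced E (V - {v})"
    using Esub by (auto simp: induced_def)
  ultimately show ?thesis
    using *[of ?F] fin by simp
qed

text \<open>A labelling that is constant on edges has no edge running between two fibres, so fibres
  can be split off one by one. Empty fibres contribute the factor \<open>1\<close>, which allows
  \<open>I\<close> to exceed the image of \<open>f\<close>.\<close>

lemma matching_poly_partition:
  assumes "finite I" "uniform r (V, E)" "r > 0" "f ` V \<subseteq> I"
    and "\<And>e x y. e \<in> E \<Longrightarrow> x \<in> e \<Longrightarrow> y \<in> e \<Longrightarrow> f x = f y"
  shows "matching_poly r (V, E) = (\<Prod>i\<in>I. matching_poly r (induced E {x \<in> V. f x = i}))"
  using assms
proof (induction I arbitrary: V E rule: finite_induct)
  case empty
  then have "V = {}" "E = {}"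
    by (auto simp: uniform_pair)
  then show ?case
    by (simp add: matching_poly_empty_edges)
next
  case (insert i I)
  let ?A = "{x \<in> V. f x = i}" and ?B = "{x \<in> V. f x \<noteq> i}"
  have Ee: "e \<subseteq> V" "e \<noteq> {}" if "e \<in> E" for e
    using that insert.prems(1,2) by (auto simp: uniform_pair)
  have E: "E = {e \<in> E. e \<subseteq> ?A} \<union> {e \<in> E. e \<subseteq> ?B}"
  proof (intro equalityI subsetI)
    fix e assume e: "e \<in> E"
    then obtain x where "x \<in> e"
      using Ee(2)[OF e] by auto
    then have "\<forall>y\<in>e. f y = f x"
      using insert.prems(4) e by blast
    then show "e \<in> {e \<in> E. e \<subseteq> ?A} \<union> {e \<in> E. e \<subseteq> ?B}"
      using Ee(1)[OF e] e by (cases "f x = i") auto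
  qed auto
  have VE: "(?A \<union> ?B, {e \<in> E. e \<subseteq> ?A} \<union> {e \<in> E. e \<subseteq> ?B}) = (V, E)"
    by (intro arg_cong2[of _ _ _ _ Pair] E[symmetric]) auto
  have "matching_poly r (?A \<union> ?B, {e \<in> E. e \<subseteq> ?A} \<union> {e \<in> E. e \<subseteq> ?B}) =
      matching_poly r (?A, {e \<in> E. e \<subseteq> ?A}) * matching_poly r (?B, {e \<in> E. e \<subseteq> ?B})"
    by (rule matching_poly_disjoint_Un) (use insert.prems(1,2) in \<open>auto simp: uniform_pair\<close>)
  then have "matching_poly r (V, E) =
      matching_poly r (induced E ?A) * matching_poly r (?B, {e \<in> E. e \<subseteq> ?B})"
    unfolding VE induced_def .
  also have "matching_poly r (?B, {e \<in> E. e \<subseteq> ?B}) =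
      (\<Prod>j\<in>I. matching_poly r (induced {e \<in> E. e \<subseteq> ?B} {x \<in> ?B. f x = j}))"
  proof (rule insert.IH)
    show "uniform r (?B, {e \<in> E. e \<subseteq> ?B})"
      using insert.prems(1) by (auto simp: uniform_pair)
    show "f ` ?B \<subseteq> I"
      using insert.prems(3) by auto
    show "f x = f y" if "e \<in> {e \<in> E. e \<subseteq> ?B}" "x \<in> e" "y \<in> e" for e x y
      using insert.prems(4)[of e x y] that by simp
  qed fact
  also have "\<dots> = (\<Prod>j\<in>I. matching_poly r (induced E {x \<in> V. f x = j}))"
  proof (rule prod.cong[OF refl])
    fix j assume "j \<in> I"
    then have "induced {e \<in> E. e \<subseteq> ?B} {x \<in> ?B. f x = j} = induced E {x \<in> V. f x = j}"
      using insert.hyps by (auto simp: induced_def)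
    then show "matching_poly r (induced {e \<in> E. e \<subseteq> ?B} {x \<in> ?B. f x = j}) =
        matching_poly r (induced E {x \<in> V. f x = j})"
      by (rule arg_cong)
  qed
  finally show ?case
    using insert.hyps by simp
qed

lemma matching_poly_image:
  assumes inj: "inj_on g V" and U: "uniform r (V, E)" and "r > 0"
  shows "matching_poly r (g ` V, (`) g ` E) = matching_poly r (V, E)"
proof -
  have fin: "finite E" and E: "E \<subseteq> Pow V"
    using uniform_finite_edges[OF U] U by (auto simp: uniform_pair)
  let ?S = "\<lambda>E. {M. M \<subseteq> E \<and> pairwise disjnt M}"
  let ?\<Phi> = "(`) ((`) g)"
  have inj1: "inj_on ((`) g) E"
    using inj_on_image_Pow[OF inj] E by (rule inj_on_subset)
  have inj2: "inj_on ?\<Phi> (Pow E)"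
    using inj1 by (rule inj_on_image_Pow)
  have dj: "disjnt (g ` e) (g ` f) \<longleftrightarrow> disjnt e f" if "e \<in> E" "f \<in> E" for e f
  proof -
    have "g ` (e \<inter> f) = g ` e \<inter> g ` f"
      using that E by (intro inj_on_image_Int[OF inj]) auto
    then show ?thesis
      unfolding disjnt_def by (metis image_is_empty)
  qed
  have pw: "pairwise disjnt (?\<Phi> M) \<longleftrightarrow> pairwise disjnt M" if "M \<subseteq> E" for M
  proof -
    have "g ` e = g ` f \<longleftrightarrow> e = f" "disjnt (g ` e) (g ` f) \<longleftrightarrow> disjnt e f" if "e \<in> M" "f \<in> M" for e f
      using that \<open>M \<subseteq> E\<close> inj_on_eq_iff[OF inj1, of e f] dj[of e f] by auto
    then show ?thesis
      unfolding pairwise_def by simp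
  qed
  have S: "?S ((`) g ` E) = ?\<Phi> ` ?S E"
    using pw by (auto simp: subset_image_iff)
  have "matching_poly r (g ` V, (`) g ` E) =
      (\<Sum>M\<in>?\<Phi> ` ?S E. monom ((-1) ^ card M) (card (g ` V) - card M * r))"
    using fin S by (simp add: matching_poly_eq_sum)
  also have "\<dots> = (\<Sum>M\<in>?S E. monom ((-1) ^ card (?\<Phi> M)) (card (g ` V) - card (?\<Phi> M) * r))"
    by (subst sum.reindex) (use inj_on_subset[OF inj2, of "?S E"] in auto)
  also have "\<dots> = (\<Sum>M\<in>?S E. monom ((-1) ^ card M) (card V - card M * r))"
  proof (rule sum.cong[OF refl])
    fix M assume "M \<in> ?S E"
    then have "card (?\<Phi> M) = card M"
      using inj1 by (intro card_image) (auto intro: inj_on_subset)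
    then show "monom ((-1) ^ card (?\<Phi> M)) (card (g ` V) - card (?\<Phi> M) * r) =
        monom ((-1) ^ card M :: real) (card V - card M * r)"
      using card_image[OF inj] by simp
  qed
  finally show ?thesis
    using fin by (simp add: matching_poly_eq_sum)
qed

section \<open>Hypertrees\<close>

text \<open>Connectedness is phrased through edge-closed vertex sets rather than walks, because such
  sets are easily extended or restricted when hypergraphs are cut or glued.\<close>

definition cut_connected :: "'a hypergraph \<Rightarrow> bool" where
  "cut_connected H \<longleftrightarrow>
    (\<forall>U. U \<subseteq> verts H \<longrightarrow> U \<noteq> {} \<longrightarrow> (\<forall>e\<in>edges H. e \<inter> U \<noteq> {} \<longrightarrow> e \<subseteq> U) \<longrightarrow> U = verts H)"

text \<open>The retraction sends a vertex to the vertex of \<open>e\<close> it remains connected to when \<open>e\<close> is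
  removed.\<close>

definition edge_retraction :: "'a hypergraph \<Rightarrow> 'a set \<Rightarrow> ('a \<Rightarrow> 'a) \<Rightarrow> bool" where
  "edge_retraction H e f \<longleftrightarrow> (\<forall>w\<in>e. f w = w) \<and> f ` verts H \<subseteq> e \<and>
    (\<forall>e'\<in>edges H - {e}. \<forall>x\<in>e'. \<forall>y\<in>e'. f x = f y)"

text \<open>Acyclicity enters as a retraction for every edge: this is the form that the splitting
  along an edge uses, and it passes to components, gluings and injective images.\<close>

definition hypertree :: "nat \<Rightarrow> 'a hypergraph \<Rightarrow> bool" where
  "hypertree r H \<longleftrightarrow> uniform r H \<and> cut_connected H \<and> (\<forall>e\<in>edges H. \<exists>f. edge_retraction H e f)"

lemma cut_connectedD:
  assumes "cut_connected (V, E)" "U \<subseteq> V" "U \<noteq> {}"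
    and "\<And>e. e \<in> E \<Longrightarrow> e \<inter> U \<noteq> {} \<Longrightarrow> e \<subseteq> U"
  shows "U = V"
  using assms unfolding cut_connected_def by simp

lemma cut_connectedI:
  assumes "\<And>U. U \<subseteq> V \<Longrightarrow> U \<noteq> {} \<Longrightarrow> (\<And>e. e \<in> E \<Longrightarrow> e \<inter> U \<noteq> {} \<Longrightarrow> e \<subseteq> U) \<Longrightarrow> U = V"
  shows "cut_connected (V, E)"
  using assms unfolding cut_connected_def by simp

lemma edge_retractionD:
  assumes "edge_retraction (V, E) e f"
  shows edge_retraction_fixed: "w \<in> e \<Longrightarrow> f w = w"
    and edge_retraction_range: "x \<in> V \<Longrightarrow> f x \<in> e"
    and edge_retraction_const: "e' \<in> E \<Longrightarrow> e' \<noteq> e \<Longrightarrow> x \<in> e' \<Longrightarrow> y \<in> e' \<Longrightarrow> f x = f y"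
  using assms unfolding edge_retraction_def verts_pair edges_pair by blast+

lemma edge_retractionI:
  assumes "\<And>w. w \<in> e \<Longrightarrow> f w = w" "\<And>x. x \<in> V \<Longrightarrow> f x \<in> e"
    and "\<And>e' x y. e' \<in> E \<Longrightarrow> e' \<noteq> e \<Longrightarrow> x \<in> e' \<Longrightarrow> y \<in> e' \<Longrightarrow> f x = f y"
  shows "edge_retraction (V, E) e f"
  using assms unfolding edge_retraction_def verts_pair edges_pair by blast

lemma edge_retraction_induced:
  assumes "edge_retraction (V, E) e f" "U \<subseteq> V"
  shows "edge_retraction (induced E U) e f"
  unfolding induced_def
proof (rule edge_retractionI)
  show "f w = w" if "w \<in> e" for w
    using edge_retraction_fixed[OF assms(1) that] .
  show "f x \<in> e" if "x \<in> U" for x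
    using edge_retraction_range[OF assms(1)] that assms(2) by auto
  show "f x = f y" if "e' \<in> {e \<in> E. e \<subseteq> U}" "e' \<noteq> e" "x \<in> e'" "y \<in> e'" for e' x y
    using edge_retraction_const[OF assms(1) _ that(2-4)] that(1) by simp
qed

text \<open>Makes induction along the edge splitting possible. The fibre meets \<open>e\<close> only
  in \<open>w\<close>, and every other edge lies inside the fibre or misses it.\<close>

lemma hypertree_component:
  assumes T: "hypertree r (V, E)" and e: "e \<in> E" and f: "edge_retraction (V, E) e f" and w: "w \<in> e"
  shows "hypertree r (induced E {x \<in> V. f x = w})"
proof -
  let ?W = "{x \<in> V. f x = w}"
  have unif: "uniform r (V, E)" and conn: "cut_connected (V, E)"
    and sep: "\<exists>f. edge_retraction (V, E) e' f" if "e' \<in> E" for e'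
    using T that by (auto simp: hypertree_def)
  have sub: "e' \<subseteq> V" if "e' \<in> E" for e'
    using unif[OF that] that by (auto simp: uniform_pair)
  have fe: "f x = x" if "x \<in> e" for x
    using edge_retraction_fixed[OF f that] .
  have fE: "f x = f y" if "e' \<in> E" "e' \<noteq> e" "x \<in> e'" "y \<in> e'" for e' x y
    using edge_retraction_const[OF f that] .
  have wV: "w \<in> ?W"
    using w sub[OF e] fe by auto
  have closed: "e' \<subseteq> ?W \<or> e' \<inter> ?W = {}" if "e' \<in> E" "e' \<noteq> e" for e'
    using sub[OF that(1)] fE[OF that] by blast
  have "cut_connected (?W, {e' \<in> E. e' \<subseteq> ?W})"
  proof (rule cut_connectedI)
    fix U
    assume U: "U \<subseteq> ?W" "U \<noteq> {}"
      and "\<And>e'. e' \<in> {e' \<in> E. e' \<subseteq> ?W} \<Longrightarrow> e' \<inter> U \<noteq> {} \<Longrightarrow> e' \<subseteq> U"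
    then have cl: "e' \<subseteq> U" if "e' \<in> E" "e' \<subseteq> ?W" "e' \<inter> U \<noteq> {}" for e'
      using that by blast
    have cl': "e' \<subseteq> U" if "e' \<in> E" "e' \<noteq> e" "e' \<inter> U \<noteq> {}" for e'
      using closed[OF that(1,2)] cl[OF that(1)] that(3) U(1) by blast
    show "U = ?W"
    proof (cases "w \<in> U")
      case True
      \<comment> \<open>Adding everything outside the fibre keeps the set closed: \<open>e\<close>
        is contained in it, as its only vertex in the fibre is \<open>w\<close>.\<close>
      have "U \<union> (V - ?W) = V"
      proof (rule cut_connectedD[OF conn[OF e]])
        fix e' assume e': "e' \<in> E" "e' \<inter> (U \<union> (V - ?W)) \<noteq> {}"
        show "e' \<subseteq> U \<union> (V - ?W)"
        proof (cases "e' = e")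
          case True
          then show ?thesis
            using \<open>w \<in> U\<close> sub[OF e] fe by auto
        next
          case False
          then show ?thesis
            using closed[OF e'(1) False] cl'[OF e'(1) False] e'(2) sub[OF e'(1)] by blast
        qed
      qed (use U in auto)
      then show ?thesis
        using U(1) by blast
    next
      case False
      \<comment> \<open>Without \<open>w\<close> the set \<open>U\<close> misses \<open>e\<close>,
        so it is already closed in the whole hypergraph; being all of \<open>V\<close> then
        contradicts \<open>w\<close> not in \<open>U\<close>.\<close>
      have "U = V"
      proof (rule cut_connectedD[OF conn[OF e]])
        fix e' assume e': "e' \<in> E" "e' \<inter> U \<noteq> {}"
        have "e' \<noteq> e"
        proof
          assume "e' = e"
          then obtain x where "x \<in> e" "x \<in> U"
            using e'(2) by auto
          then have "x = w"
            using fe[of x] U(1) by auto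
          then show False
            using False \<open>x \<in> U\<close> by simp
        qed
        then show "e' \<subseteq> U"
          using cl' e' by simp
      qed (use U in auto)
      then show ?thesis
        using False wV by auto
    qed
  qed
  moreover have "\<exists>f. edge_retraction (induced E ?W) e' f" if e': "e' \<in> E" for e'
  proof -
    obtain g where "edge_retraction (V, E) e' g"
      using sep[OF e'] ..
    then have "edge_retraction (induced E ?W) e' g"
      by (rule edge_retraction_induced) auto
    then show ?thesis
      by blast
  qed
  ultimately show ?thesis
    using uniform_induced[OF unif[OF e], of ?W] by (auto simp: hypertree_def induced_def)
qed

text \<open>The second piece hangs on the first at \<open>c\<close> alone, so all of it must follow
  \<open>c\<close>.\<close>

lemma edge_retraction_glue:
  assumes "uniform r (V1, E1)" "uniform r (V2, E2)" "V1 \<inter> V2 = {c}" "e \<in> E1"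
    and f: "edge_retraction (V1, E1) e f"
  shows "edge_retraction (V1 \<union> V2, E1 \<union> E2) e (\<lambda>x. if x \<in> V1 then f x else f c)"
proof -
  have c: "c \<in> V1"
    using assms(3) by auto
  have sub: "e' \<subseteq> V1" if "e' \<in> E1" for e'
    using assms(1) that by (auto simp: uniform_pair)
  have sub2: "e' \<subseteq> V2" if "e' \<in> E2" for e'
    using assms(2) that by (auto simp: uniform_pair)
  let ?f = "\<lambda>x. if x \<in> V1 then f x else f c"
  show ?thesis
  proof (rule edge_retractionI)
    show "?f w = w" if "w \<in> e" for w
      using sub[OF assms(4)] that edge_retraction_fixed[OF f that] by auto
    show "?f x \<in> e" for x
      using edge_retraction_range[OF f] c by simp
    fix e' x y assume e': "e' \<in> E1 \<union> E2" "e' \<noteq> e" "x \<in> e'" "y \<in> e'"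
    show "?f x = ?f y"
    proof (cases "e' \<in> E1")
      case True
      then have "x \<in> V1" "y \<in> V1"
        using sub e' by auto
      then show ?thesis
        using edge_retraction_const[OF f True e'(2-4)] by simp
    next
      case False
      then have "x \<in> V2" "y \<in> V2"
        using sub2[of e'] e' by auto
      then have "?f x = f c" "?f y = f c"
        using assms(3) by auto
      then show ?thesis
        by simp
    qed
  qed
qed

text \<open>Retractions extend from either side. For connectedness, an edge-closed set that meets
  one piece fills it, hence contains \<open>c\<close> and fills the other piece too.\<close>

lemma hypertree_glue:
  assumes T1: "hypertree r (V1, E1)" and T2: "hypertree r (V2, E2)" and c: "V1 \<inter> V2 = {c}"
  shows "hypertree r (V1 \<union> V2, E1 \<union> E2)"
proof -
  have unif: "uniform r (V1, E1)" "uniform r (V2, E2)"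
    and conn: "cut_connected (V1, E1)" "cut_connected (V2, E2)"
    using T1 T2 by (auto simp: hypertree_def)
  have "\<exists>f. edge_retraction (V1 \<union> V2, E1 \<union> E2) e f" if e: "e \<in> E1 \<union> E2" for e
  proof (cases "e \<in> E1")
    case True
    then obtain f where "edge_retraction (V1, E1) e f"
      using T1 unfolding hypertree_def edges_pair by blast
    then show ?thesis
      using edge_retraction_glue[OF unif c True] by blast
  next
    case False
    have c': "V2 \<inter> V1 = {c}"
      using c by auto
    have "e \<in> E2"
      using False e by auto
    then obtain f where "edge_retraction (V2, E2) e f"
      using T2 unfolding hypertree_def edges_pair by blast
    then have "\<exists>f. edge_retraction (V2 \<union> V1, E2 \<union> E1) e f"
      using edge_retraction_glue[OF unif(2,1) c' \<open>e \<in> E2\<close>] by blast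
    then show ?thesis
      by (simp add: Un_commute)
  qed
  moreover have "cut_connected (V1 \<union> V2, E1 \<union> E2)"
  proof (rule cut_connectedI)
    fix U
    assume U: "U \<subseteq> V1 \<union> V2" "U \<noteq> {}"
      and cl: "\<And>e. e \<in> E1 \<union> E2 \<Longrightarrow> e \<inter> U \<noteq> {} \<Longrightarrow> e \<subseteq> U"
    have sub: "e \<subseteq> V1" if "e \<in> E1" for e
      using unif that by (auto simp: uniform_pair)
    have sub2: "e \<subseteq> V2" if "e \<in> E2" for e
      using unif that by (auto simp: uniform_pair)
    have 1: "U \<inter> V1 = V1" if "U \<inter> V1 \<noteq> {}"
    proof (rule cut_connectedD[OF conn(1) _ that])
      fix e assume "e \<in> E1" "e \<inter> (U \<inter> V1) \<noteq> {}"
      then show "e \<subseteq> U \<inter> V1"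
        using sub[of e] cl[of e] by auto
    qed auto
    have 2: "U \<inter> V2 = V2" if "U \<inter> V2 \<noteq> {}"
    proof (rule cut_connectedD[OF conn(2) _ that])
      fix e assume "e \<in> E2" "e \<inter> (U \<inter> V2) \<noteq> {}"
      then show "e \<subseteq> U \<inter> V2"
        using sub2[of e] cl[of e] by auto
    qed auto
    have "c \<in> V1" "c \<in> V2"
      using c by auto
    then show "U = V1 \<union> V2"
      using U 1 2 by blast
  qed
  moreover have "uniform r (V1 \<union> V2, E1 \<union> E2)"
    using unif by (auto simp: uniform_pair)
  ultimately show ?thesis
    by (simp add: hypertree_def)
qed

lemma uniform_image:
  assumes "uniform r (V, E)" and g: "inj_on g V"
  shows "uniform r (g ` V, (`) g ` E)"
proof -
  have "card (g ` e) = r" if "e \<in> E" for e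
    using assms that card_image[OF inj_on_subset[OF g, of e]] by (auto simp: uniform_pair)
  then show ?thesis
    using assms(1) by (auto simp: uniform_pair)
qed

lemma hypertree_image:
  assumes T: "hypertree r (V, E)" and g: "inj_on g V"
  shows "hypertree r (g ` V, (`) g ` E)"
proof -
  have unif: "uniform r (V, E)" and conn: "cut_connected (V, E)"
    using T by (auto simp: hypertree_def)
  have sub: "e \<subseteq> V" if "e \<in> E" for e
    using unif that by (auto simp: uniform_pair)
  have inv: "inv_into V g (g x) = x" if "x \<in> V" for x
    using g that by (rule inv_into_f_f)
  have "cut_connected (g ` V, (`) g ` E)"
  proof (rule cut_connectedI)
    fix U
    assume U: "U \<subseteq> g ` V" "U \<noteq> {}" and cl: "\<And>e. e \<in> (`) g ` E \<Longrightarrow> e \<inter> U \<noteq> {} \<Longrightarrow> e \<subseteq> U"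
    have "{x \<in> V. g x \<in> U} = V"
    proof (rule cut_connectedD[OF conn])
      fix e assume "e \<in> E" "e \<inter> {x \<in> V. g x \<in> U} \<noteq> {}"
      then show "e \<subseteq> {x \<in> V. g x \<in> U}"
        using cl[of "g ` e"] sub[of e] by auto
    qed (use U in auto)
    then show "U = g ` V"
      using U(1) by auto
  qed
  moreover have "\<exists>f. edge_retraction (g ` V, (`) g ` E) e f" if e: "e \<in> (`) g ` E" for e
  proof -
    obtain e0 where e0: "e = g ` e0" "e0 \<in> E"
      using e by (rule imageE)
    obtain f where f: "edge_retraction (V, E) e0 f"
      using T e0(2) unfolding hypertree_def edges_pair by blast
    have "edge_retraction (g ` V, (`) g ` E) e (\<lambda>x. g (f (inv_into V g x)))"
    proof (rule edge_retractionI)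
      fix w assume "w \<in> e"
      then obtain w0 where "w = g w0" "w0 \<in> e0"
        using e0 by auto
      then show "g (f (inv_into V g w)) = w"
        using inv[of w0] sub[OF e0(2)] edge_retraction_fixed[OF f] by auto
    next
      fix x assume "x \<in> g ` V"
      then show "g (f (inv_into V g x)) \<in> e"
        using inv edge_retraction_range[OF f] e0(1) by auto
    next
      fix e' x y assume e': "e' \<in> (`) g ` E" "e' \<noteq> e" "x \<in> e'" "y \<in> e'"
      obtain e1 where e1: "e' = g ` e1" "e1 \<in> E"
        using e'(1) by (rule imageE)
      obtain x0 y0 where *: "x0 \<in> e1" "y0 \<in> e1" "x = g x0" "y = g y0"
        using e' e1 by auto
      have "f x0 = f y0"
        using edge_retraction_const[OF f e1(2) _ *(1,2)] e' e1 e0 by auto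
      then show "g (f (inv_into V g x)) = g (f (inv_into V g y))"
        using * inv[OF subsetD[OF sub[OF e1(2)] *(1)]] inv[OF subsetD[OF sub[OF e1(2)] *(2)]] by simp
    qed
    then show ?thesis
      by blast
  qed
  ultimately show ?thesis
    using uniform_image[OF unif g] by (simp add: hypertree_def)
qed

section \<open>Supertrees are hypertrees\<close>

text \<open>Closing up a shortest walk avoiding \<open>e\<close> with \<open>e\<close> itself yields a Berge cycle.\<close>

lemma acyclic_no_bypass:
  assumes ac: "acyclic_hg (V, E)" and e: "e \<in> E" "w \<in> e" "w' \<in> e"
    and walk: "(w, w') \<in> (adjacent_rel (V, E - {e}))\<^sup>*"
  shows "w = w'"
proof (rule ccontr)
  assume neq: "w \<noteq> w'"
  define R where "R = adjacent_rel (V, E - {e})"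
  define n where "n = (LEAST n. (w, w') \<in> R ^^ n)"
  have "\<exists>n. (w, w') \<in> R ^^ n"
    using walk unfolding R_def by (simp add: rtrancl_power)
  then have wn: "(w, w') \<in> R ^^ n"
    unfolding n_def by (rule LeastI_ex)
  have least: "n \<le> k" if "(w, w') \<in> R ^^ k" for k
    unfolding n_def using that by (rule Least_le)
  obtain p where p: "p 0 = w" "p n = w'" "\<forall>i<n. (p i, p (Suc i)) \<in> R"
    using wn by (auto simp: relpow_fun_conv)
  have sub: "(p i, p (i + k)) \<in> R ^^ k" if "i + k \<le> n" for i k
    unfolding relpow_fun_conv by (rule exI[of _ "\<lambda>l. p (i + l)"]) (use p that in auto)
  \<comment> \<open>Minimality of \<open>n\<close> forbids shortcuts. The case \<open>k = 0\<close>
    will make the vertices distinct; \<open>k = 1\<close> will make the edges distinct, since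
    \<open>d i = d j\<close> would join \<open>p i\<close> directly to
    \<open>p (Suc j)\<close>.\<close>
  have short: "j \<le> i + k" if "i \<le> j" "j \<le> n" "(p i, p j) \<in> R ^^ k" for i j k
  proof -
    have "(w, p i) \<in> R ^^ i"
      using sub[of 0 i] p(1) that by simp
    moreover have "(p j, w') \<in> R ^^ (n - j)"
      using sub[of j "n - j"] p(2) that by simp
    ultimately have "(w, w') \<in> R ^^ (i + (k + (n - j)))"
      using that(3) unfolding relpow_add by blast
    from least[OF this] show ?thesis
      using that by linarith
  qed
  have "\<forall>i<n. \<exists>d. d \<in> E - {e} \<and> p i \<in> d \<and> p (Suc i) \<in> d"
    using p(3) by (auto simp: R_def adjacent_rel_def)
  then obtain d where d: "\<And>i. i < n \<Longrightarrow> d i \<in> E - {e} \<and> p i \<in> d i \<and> p (Suc i) \<in> d i"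
    by metis
  have n: "n > 0"
    using p neq by (cases n) auto
  have inj_p: "inj_on p {0..<Suc n}"
  proof (rule linorder_inj_onI')
    fix i j assume ij: "i \<in> {0..<Suc n}" "j \<in> {0..<Suc n}" "i < j"
    show "p i \<noteq> p j"
      using short[of i j 0] ij by auto
  qed
  have inj_d: "inj_on d {0..<n}"
  proof (rule linorder_inj_onI')
    fix i j assume ij: "i \<in> {0..<n}" "j \<in> {0..<n}" "i < j"
    show "d i \<noteq> d j"
    proof
      assume eq: "d i = d j"
      have "(p i, p (Suc j)) \<in> R"
        using d[of i] d[of j] ij eq unfolding R_def adjacent_rel_def edges_pair by auto
      then show False
        using short[of i "Suc j" 1] ij by auto
    qed
  qed
  \<comment> \<open>There are \<open>n + 1\<close> vertices and \<open>n\<close> walk edges; the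
    final edge \<open>e\<close> leads from \<open>p n = w'\<close> back to \<open>p 0 = w\<close>,
    which is the wrap-around index.\<close>
  let ?vs = "map p [0..<Suc n]" and ?es = "map d [0..<n] @ [e]"
  have "berge_cycle (V, E) ?vs ?es"
    unfolding berge_cycle_def edges_pair
  proof (intro conjI allI impI)
    show "2 \<le> length ?vs" "length ?es = length ?vs"
      using n by auto
    show "distinct ?vs"
      using inj_p by (simp add: distinct_map del: upt_Suc)
    have "e \<notin> set (map d [0..<n])"
      using d by fastforce
    then show "distinct ?es"
      using inj_d by (simp add: distinct_map)
    show "set ?es \<subseteq> E"
      using d e by auto
    fix i assume "i < length ?vs"
    then have i: "i < Suc n"
      by simp
    show "?vs ! i \<in> ?es ! i"
    proof (cases "i = n")
      case True
      then show ?thesis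
        using p e by (simp add: nth_append del: upt_Suc)
    next
      case False
      then show ?thesis
        using i d[of i] by (simp add: nth_append del: upt_Suc)
    qed
    show "?vs ! ((i + 1) mod length ?vs) \<in> ?es ! i"
    proof (cases "i = n")
      case True
      then show ?thesis
        using p e by (simp add: nth_append del: upt_Suc)
    next
      case False
      then have "(i + 1) mod length ?vs = Suc i"
        using i by simp
      then show ?thesis
        using False i d[of i] by (simp add: nth_append del: upt_Suc)
    qed
  qed
  then show False
    using ac unfolding acyclic_hg_def by blast
qed

text \<open>Reachability without \<open>e\<close> defines the retraction: connectedness supplies a
  vertex of \<open>e\<close> for each vertex, and \<open>acyclic_no_bypass\<close> makes it
  unique.\<close>

lemma supertree_hypertree:
  assumes T: "supertree r (V, E)" and "r > 0"
  shows "hypertree r (V, E)"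
proof -
  have unif: "uniform r (V, E)" and conn: "connected_hg (V, E)" and ac: "acyclic_hg (V, E)"
    using T by (auto simp: supertree_def)
  have sub: "e \<subseteq> V" "e \<noteq> {}" if "e \<in> E" for e
    using unif that \<open>r > 0\<close> by (auto simp: uniform_pair)
  have cut: "cut_connected (V, E)"
  proof (rule cut_connectedI)
    fix U assume U: "U \<subseteq> V" "U \<noteq> {}" and cl: "\<And>e. e \<in> E \<Longrightarrow> e \<inter> U \<noteq> {} \<Longrightarrow> e \<subseteq> U"
    obtain x where x: "x \<in> U"
      using U by auto
    have "y \<in> U" if "y \<in> V" for y
    proof -
      have "(x, y) \<in> (adjacent_rel (V, E))\<^sup>*"
        using conn x U that by (auto simp: connected_hg_def)
      then show ?thesis
      proof (induction rule: rtrancl_induct)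
        case (step y z)
        then obtain e where "e \<in> E" "y \<in> e" "z \<in> e"
          unfolding adjacent_rel_def edges_pair by auto
        then show ?case
          using cl[of e] step by auto
      qed (rule x)
    qed
    then show "U = V"
      using U by auto
  qed
  have "\<exists>f. edge_retraction (V, E) e f" if e: "e \<in> E" for e
  proof -
    define R where "R = adjacent_rel (V, E - {e})"
    have edgeR: "(x, y) \<in> R" if "e' \<in> E" "e' \<noteq> e" "x \<in> e'" "y \<in> e'" for e' x y
      using that unfolding R_def adjacent_rel_def edges_pair by auto
    have symR: "sym (R\<^sup>*)"
      by (rule sym_rtrancl) (auto simp: R_def adjacent_rel_def sym_def)
    have unique: "w = w'" if "w \<in> e" "w' \<in> e" "(w, x) \<in> R\<^sup>*" "(w', x) \<in> R\<^sup>*" for w w' x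
    proof (rule acyclic_no_bypass[OF ac e that(1,2)])
      have "(x, w') \<in> R\<^sup>*"
        using symR that(4) by (rule symD)
      then show "(w, w') \<in> (adjacent_rel (V, E - {e}))\<^sup>*"
        using that(3) unfolding R_def by simp
    qed
    have "{x \<in> V. \<exists>w\<in>e. (w, x) \<in> R\<^sup>*} = V" (is "?U = V")
    proof (rule cut_connectedD[OF cut])
      have eU: "e \<subseteq> ?U"
        using sub[OF e] by auto
      then show "?U \<noteq> {}"
        using sub(2)[OF e] by blast
      fix e' assume e': "e' \<in> E" "e' \<inter> ?U \<noteq> {}"
      show "e' \<subseteq> ?U"
      proof (cases "e' = e")
        case False
        obtain x w where xw: "x \<in> e'" "w \<in> e" "(w, x) \<in> R\<^sup>*"
          using e'(2) by auto
        show ?thesis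
        proof
          fix y assume "y \<in> e'"
          then have "(w, y) \<in> R\<^sup>*"
            using xw(3) edgeR[OF e'(1) False xw(1)] by (meson rtrancl.rtrancl_into_rtrancl)
          then show "y \<in> ?U"
            using xw(2) sub(1)[OF e'(1)] \<open>y \<in> e'\<close> by auto
        qed
      qed (use eU in simp)
    qed auto
    then have "\<forall>x\<in>V. \<exists>w. w \<in> e \<and> (w, x) \<in> R\<^sup>*"
      by blast
    then obtain f where f: "\<And>x. x \<in> V \<Longrightarrow> f x \<in> e \<and> (f x, x) \<in> R\<^sup>*"
      by metis
    have "edge_retraction (V, E) e f"
    proof (rule edge_retractionI)
      fix w assume "w \<in> e"
      then show "f w = w"
        using f[of w] unique[of "f w" w w] sub(1)[OF e] by auto
    next
      fix e' x y assume e': "e' \<in> E" "e' \<noteq> e" "x \<in> e'" "y \<in> e'"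
      then have V: "x \<in> V" "y \<in> V"
        using sub(1) by auto
      have "(f x, y) \<in> R\<^sup>*"
        using f[OF V(1)] edgeR[OF e'] by (meson rtrancl.rtrancl_into_rtrancl)
      then show "f x = f y"
        using f[OF V(1)] f[OF V(2)] unique by blast
    qed (use f in blast)
    then show ?thesis
      by blast
  qed
  then show ?thesis
    using unif cut unfolding hypertree_def edges_pair by blast
qed

section \<open>The largest root of the matching polynomial\<close>

lemma induced_induced: "U \<subseteq> W \<Longrightarrow> induced {e \<in> E. e \<subseteq> W} U = induced E U"
  unfolding induced_def by auto

text \<open>Only \<open>e\<close> joins different fibres of \<open>f\<close>. Once \<open>e\<close>
  is deleted, or loses a vertex, the polynomial factors over the fibres.\<close>

lemma matching_poly_edge_decomposition:
  assumes unif: "uniform r (V, E)" and e: "e \<in> E" and f: "edge_retraction (V, E) e f" and r: "r \<ge> 2"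
  defines "A \<equiv> \<lambda>w. matching_poly r (induced E {x \<in> V. f x = w})"
    and "B \<equiv> \<lambda>w. matching_poly r (induced E ({x \<in> V. f x = w} - {w}))"
  shows matching_poly_edge_split: "matching_poly r (V, E) = (\<Prod>w\<in>e. A w) - (\<Prod>w\<in>e. B w)"
    and matching_poly_edge_removed: "matching_poly r (induced E (V - e)) = (\<Prod>w\<in>e. B w)"
    and matching_poly_vertex_removed:
      "p \<in> e \<Longrightarrow> matching_poly r (induced E (V - {p})) = B p * (\<Prod>w\<in>e - {p}. A w)"
proof -
  have fin: "finite V" "finite e" and sub: "e \<subseteq> V" and card: "card e \<ge> 2" "e \<noteq> {}"
    using unif e r by (auto simp: uniform_pair intro: finite_subset)
  have fe: "f w = w" if "w \<in> e" for w
    using edge_retraction_fixed[OF f that] .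
  have part: "matching_poly r (induced E U) = (\<Prod>w\<in>e. matching_poly r (induced E {x \<in> U. f x = w}))"
    if U: "U \<subseteq> V" "\<not> e \<subseteq> U" for U
  proof -
    have "matching_poly r (U, {e \<in> E. e \<subseteq> U}) =
        (\<Prod>w\<in>e. matching_poly r (induced {e \<in> E. e \<subseteq> U} {x \<in> U. f x = w}))"
    proof (rule matching_poly_partition[OF fin(2)])
      show "uniform r (U, {e \<in> E. e \<subseteq> U})"
        using uniform_induced[OF unif U(1)] by (simp add: induced_def)
      show "f ` U \<subseteq> e"
        using edge_retraction_range[OF f] U(1) by auto
      show "f x = f y" if "e' \<in> {e \<in> E. e \<subseteq> U}" "x \<in> e'" "y \<in> e'" for e' x y
        using edge_retraction_const[OF f _ _ that(2,3)] that(1) U(2) by auto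
    qed (use r in auto)
    also have "\<dots> = (\<Prod>w\<in>e. matching_poly r (induced E {x \<in> U. f x = w}))"
      by (intro prod.cong refl arg_cong[of _ _ "matching_poly r"] induced_induced) auto
    finally show ?thesis
      by (simp add: induced_def)
  qed
  show removed: "matching_poly r (induced E (V - e)) = (\<Prod>w\<in>e. B w)"
  proof -
    have "{x \<in> V - e. f x = w} = {x \<in> V. f x = w} - {w}" if "w \<in> e" for w
      using fe that by auto
    then show ?thesis
      using part[of "V - e"] card(2) unfolding B_def by auto
  qed
  show "matching_poly r (induced E (V - {p})) = B p * (\<Prod>w\<in>e - {p}. A w)" if p: "p \<in> e"
  proof -
    have "matching_poly r (induced E (V - {p})) =
        (\<Prod>w\<in>e. matching_poly r (induced E {x \<in> V - {p}. f x = w}))"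
      by (rule part) (use p in auto)
    also have "\<dots> = matching_poly r (induced E {x \<in> V - {p}. f x = p}) *
        (\<Prod>w\<in>e - {p}. matching_poly r (induced E {x \<in> V - {p}. f x = w}))"
      by (rule prod.remove[OF fin(2) p])
    also have "{x \<in> V - {p}. f x = p} = {x \<in> V. f x = p} - {p}"
      by auto
    also have "(\<Prod>w\<in>e - {p}. matching_poly r (induced E {x \<in> V - {p}. f x = w})) =
        (\<Prod>w\<in>e - {p}. A w)"
    proof (rule prod.cong[OF refl])
      fix w assume "w \<in> e - {p}"
      then have "{x \<in> V - {p}. f x = w} = {x \<in> V. f x = w}"
        using fe[OF p] by auto
      then show "matching_poly r (induced E {x \<in> V - {p}. f x = w}) = A w"
        by (simp add: A_def)
    qed
    finally show ?thesis
      by (simp add: B_def)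
  qed
  have "matching_poly r (V, E - {e}) =
      (\<Prod>w\<in>e. matching_poly r (induced (E - {e}) {x \<in> V. f x = w}))"
  proof (rule matching_poly_partition[OF fin(2)])
    show "uniform r (V, E - {e})"
      using unif by (auto simp: uniform_pair)
    show "f ` V \<subseteq> e"
      using edge_retraction_range[OF f] by auto
    show "f x = f y" if "e' \<in> E - {e}" "x \<in> e'" "y \<in> e'" for e' x y
      using edge_retraction_const[OF f _ _ that(2,3)] that(1) by auto
  qed (use r in auto)
  also have "\<dots> = (\<Prod>w\<in>e. A w)"
  proof (rule prod.cong[OF refl])
    fix w assume w: "w \<in> e"
    \<comment> \<open>\<open>e\<close> has at least two vertices, each in a fibre of its own, so
      deleting \<open>e\<close> changes nothing inside a single fibre.\<close>
    have "\<not> e \<subseteq> {x \<in> V. f x = w}"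
    proof
      assume "e \<subseteq> {x \<in> V. f x = w}"
      then have "e \<subseteq> {w}"
        using fe by auto
      then have "card e \<le> card {w}"
        by (intro card_mono) auto
      then show False
        using card by simp
    qed
    then have "{e' \<in> E - {e}. e' \<subseteq> {x \<in> V. f x = w}} = {e' \<in> E. e' \<subseteq> {x \<in> V. f x = w}}"
      by blast
    then show "matching_poly r (induced (E - {e}) {x \<in> V. f x = w}) = A w"
      by (simp add: A_def induced_def)
  qed
  finally show "matching_poly r (V, E) = (\<Prod>w\<in>e. A w) - (\<Prod>w\<in>e. B w)"
    using matching_poly_delete_edge[OF unif e] r removed by simp
qed

text \<open>At the largest root \<open>t\<close> the hypothesis holds, and the conclusion makes the Perron vector
  strictly positive.\<close>

lemma hypertree_vertex_removed_pos:
  assumes "hypertree r (V, E)" "r \<ge> 2" "p \<in> V"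
    and "\<And>U. U \<subseteq> V \<Longrightarrow> poly (matching_poly r (induced E U)) t \<ge> 0"
  shows "poly (matching_poly r (induced E (V - {p}))) t > 0"
  using assms
proof (induction "card V" arbitrary: V E p rule: less_induct)
  case less
  have unif: "uniform r (V, E)" and conn: "cut_connected (V, E)"
    using less.prems(1) by (auto simp: hypertree_def)
  have fin: "finite V"
    using unif by (simp add: uniform_pair)
  show ?case
  proof (cases "V = {p}")
    case True
    have "induced E (V - {p}) = ({}, {})"
      using unif less.prems(2) True by (auto simp: uniform_pair induced_def)
    then show ?thesis
      by (simp add: matching_poly_empty_edges)
  next
    case False
    have "\<exists>e\<in>E. p \<in> e"
    proof (rule ccontr)
      assume "\<not> (\<exists>e\<in>E. p \<in> e)"
      then have "{p} = V"
        using less.prems(3) by (intro cut_connectedD[OF conn]) auto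
      then show False
        using False by simp
    qed
    then obtain e where e: "e \<in> E" "p \<in> e"
      by blast
    obtain f where f: "edge_retraction (V, E) e f"
      using less.prems(1) e(1) unfolding hypertree_def edges_pair by blast
    have sub: "e \<subseteq> V" "card e = r" "finite e"
      using unif e fin by (auto simp: uniform_pair intro: finite_subset)
    define W where "W = (\<lambda>w. {x \<in> V. f x = w})"
    define A where "A = (\<lambda>w. poly (matching_poly r (induced E (W w))) t)"
    define B where "B = (\<lambda>w. poly (matching_poly r (induced E (W w - {w}))) t)"
    note dec = matching_poly_edge_decomposition[OF unif e(1) f less.prems(2)]
    have Bpos: "B w > 0" if w: "w \<in> e" for w
    proof -
      have "\<exists>w'\<in>e. w' \<noteq> w"
      proof (rule ccontr)
        assume "\<not> (\<exists>w'\<in>e. w' \<noteq> w)"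
        then have "card e \<le> card {w}"
          by (intro card_mono) auto
        then show False
          using sub less.prems(2) by simp
      qed
      then obtain w' where w': "w' \<in> e" "w' \<noteq> w"
        by blast
      have "w' \<notin> W w"
        using edge_retraction_fixed[OF f w'(1)] w'(2) by (simp add: W_def)
      then have "W w \<subset> V"
        using w' sub by (auto simp: W_def)
      then have card: "card (W w) < card V"
        using fin by (rule psubset_card_mono[rotated])
      \<comment> \<open>The induction hypothesis applies because nonnegativity is assumed for all
        vertex subsets and is thus inherited by components.\<close>
      have "poly (matching_poly r (induced {e \<in> E. e \<subseteq> W w} (W w - {w}))) t > 0"
      proof (rule less.hyps[OF card])
        show "hypertree r (W w, {e \<in> E. e \<subseteq> W w})"
          using hypertree_component[OF less.prems(1) e(1) f w] by (simp add: W_def induced_def)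
        show "w \<in> W w"
          using edge_retraction_fixed[OF f w] w sub by (auto simp: W_def)
        show "0 \<le> poly (matching_poly r (induced {e \<in> E. e \<subseteq> W w} U)) t" if "U \<subseteq> W w" for U
          unfolding induced_induced[OF that] using that by (intro less.prems(4)) (auto simp: W_def)
      qed fact
      then show ?thesis
        by (simp add: B_def induced_induced)
    qed
    \<comment> \<open>This makes the product of the \<open>A w\<close> at least that of the
      \<open>B w\<close>, which is positive; the nonnegative factors \<open>A w\<close> then cannot
      vanish.\<close>
    have "0 \<le> poly (matching_poly r (V, E)) t"
      using less.prems(4)[of V] by (simp add: induced_self[OF unif])
    also have "\<dots> = (\<Prod>w\<in>e. A w) - (\<Prod>w\<in>e. B w)"
      unfolding dec(1) by (simp add: A_def B_def W_def poly_prod)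
    finally have "(\<Prod>w\<in>e. A w) \<noteq> 0"
      using prod_pos[of e B] Bpos by force
    then have Apos: "A w > 0" if "w \<in> e" for w
      using that sub(3) less.prems(4)[of "W w"] by (force simp: A_def W_def less_le)
    have "poly (matching_poly r (induced E (V - {p}))) t = B p * (\<Prod>w\<in>e - {p}. A w)"
      unfolding dec(3)[OF e(2)] by (simp add: A_def B_def W_def poly_prod)
    also have "\<dots> > 0"
      using Bpos e(2) Apos by (intro mult_pos_pos prod_pos) auto
    finally show ?thesis .
  qed
qed

text \<open>The polynomial is eventually positive, so a negative value at \<open>t\<close> would
  force a further root to the right of \<open>t\<close>.\<close>

lemma poly_nonneg_beyond_roots:
  fixes p :: "real poly"
  assumes "lead_coeff p > 0" and "\<And>s. poly p s = 0 \<Longrightarrow> s \<le> t"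
  shows "poly p t \<ge> 0"
proof (rule ccontr)
  assume "\<not> poly p t \<ge> 0"
  then have neg: "poly p t < 0"
    by simp
  obtain n where n: "\<forall>x\<ge>n. poly p x \<ge> lead_coeff p"
    using poly_pinfty_gt_lc[OF assms(1)] by blast
  have "poly p (max n (t + 1)) > 0"
    using n assms(1) by (meson max.cobounded1 order.strict_trans2)
  then obtain x where "x > t" "poly p x = 0"
    using poly_IVT_pos[OF _ neg, of "max n (t + 1)"] by (auto simp: less_max_iff_disj)
  then show False
    using assms(2)[of x] by simp
qed

text \<open>The witness is the largest root of all induced subhypergraphs. By the vertex recursion a zero
  at that point propagates from an induced subhypergraph to the whole hypergraph.\<close>

lemma ex_dominant_root:
  assumes unif: "uniform r (V, E)" and r: "r \<ge> 2" and "V \<noteq> {}"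
  obtains t where "poly (matching_poly r (V, E)) t = 0"
    and "\<And>s. poly (matching_poly r (V, E)) s = 0 \<Longrightarrow> s \<le> t"
    and "\<And>U. U \<subseteq> V \<Longrightarrow> poly (matching_poly r (induced E U)) t \<ge> 0"
proof -
  let ?p = "\<lambda>U. matching_poly r (induced E U)"
  have monic: "lead_coeff (?p U) = 1" if "U \<subseteq> V" for U
    using matching_poly_monic[OF uniform_induced[OF unif that, unfolded induced_def]] r
    by (simp add: induced_def)
  define R where "R = (\<Union>U\<in>Pow V. {s. poly (?p U) s = 0})"
  have "finite R"
    unfolding R_def
  proof (rule finite_UN_I)
    show "finite (Pow V)"
      using unif by (simp add: uniform_pair)
    show "finite {s. poly (?p U) s = 0}" if "U \<in> Pow V" for U
      using monic[of U] that by (intro poly_roots_finite) auto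
  qed
  obtain v where v: "v \<in> V"
    using \<open>V \<noteq> {}\<close> by auto
  \<comment> \<open>A single vertex has matching polynomial \<open>x\<close>; its root
    \<open>0\<close> shows that the maximum is taken over a nonempty set.\<close>
  have "induced E {v} = ({v}, {})"
  proof -
    have "\<not> e \<subseteq> {v}" if "e \<in> E" for e
      using card_mono[of "{v}" e] unif that r by (auto simp: uniform_pair)
    then show ?thesis
      by (auto simp: induced_def)
  qed
  then have "poly (?p {v}) 0 = 0"
    by (simp add: matching_poly_empty_edges poly_monom)
  then have "R \<noteq> {}"
    using v by (auto simp: R_def)
  define t where "t = Max R"
  have tR: "t \<in> R" and maxR: "\<And>s. s \<in> R \<Longrightarrow> s \<le> t"
    using \<open>finite R\<close> \<open>R \<noteq> {}\<close> by (auto simp: t_def)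
  have nonneg: "poly (?p U) t \<ge> 0" if "U \<subseteq> V" for U
    using that maxR by (intro poly_nonneg_beyond_roots) (auto simp: monic R_def)
  obtain U0 where U0: "U0 \<subseteq> V" "poly (?p U0) t = 0"
    using tR by (auto simp: R_def)
  have "poly (?p (U0 \<union> W)) t = 0" if "finite W" "W \<subseteq> V" for W
    using that
  proof (induction W rule: finite_induct)
    case (insert x W)
    show ?case
    proof (cases "x \<in> U0")
      case True
      then have "U0 \<union> insert x W = U0 \<union> W"
        by auto
      then show ?thesis
        using insert by simp
    next
      case False
      let ?U = "U0 \<union> insert x W"
      have UV: "?U \<subseteq> V"
        using U0(1) insert.prems by auto
      have Ux: "?U - {x} = U0 \<union> W"
        using False insert.hyps by auto
      have "?p ?U = [:0, 1:] * ?p (?U - {x}) - (\<Sum>e | e \<in> {e \<in> E. e \<subseteq> ?U} \<and> x \<in> e. ?p (?U - e))"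
        using matching_poly_vertex_recursion[of r ?U "{e \<in> E. e \<subseteq> ?U}" x] uniform_induced[OF unif UV] r
        by (simp only: induced_induced[OF Diff_subset] induced_def[of E ?U, symmetric]) auto
      then have "poly (?p ?U) t = t * poly (?p (U0 \<union> W)) t -
          (\<Sum>e | e \<in> {e \<in> E. e \<subseteq> ?U} \<and> x \<in> e. poly (?p (?U - e)) t)"
        unfolding Ux by (simp add: poly_sum)
      moreover have "poly (?p (U0 \<union> W)) t = 0"
        using insert by simp
      moreover have "(\<Sum>e | e \<in> {e \<in> E. e \<subseteq> ?U} \<and> x \<in> e. poly (?p (?U - e)) t) \<ge> 0"
        using UV by (intro sum_nonneg nonneg) auto
      \<comment> \<open>The recursion leaves minus a nonnegative sum, whereas the value itself is
        nonnegative; hence it is zero.\<close>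
      ultimately show ?thesis
        using nonneg[OF UV] by simp
    qed
  qed (use U0 in simp)
  from this[of V] have "poly (?p V) t = 0"
    using unif U0(1) by (simp add: uniform_pair Un_absorb1)
  then have "poly (matching_poly r (V, E)) t = 0"
    by (simp add: induced_self[OF unif])
  moreover have "s \<le> t" if "poly (matching_poly r (V, E)) s = 0" for s
    using that induced_self[OF unif] by (intro maxR) (auto simp: R_def intro!: bexI[of _ V])
  ultimately show thesis
    using nonneg that by blast
qed

section \<open>The spectral radius\<close>

text \<open>Each edge at \<open>i\<close> arises from the \<open>(r - 1)!\<close> orderings of its
  other vertices, which cancels the normalising factor of the tensor.\<close>

lemma adj_tensor_sum:
  assumes unif: "uniform r (V, E)" and "r > 0"
  shows "(\<Sum>js\<in>{js. length js = r - 1 \<and> set js \<subseteq> V}.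
      adj_tensor r (V, E) (i # js) * prod_list (map x js)) =
    (\<Sum>e | e \<in> E \<and> i \<in> e. \<Prod>w\<in>e - {i}. x w)"
proof -
  let ?S = "{js. length js = r - 1 \<and> set js \<subseteq> V}"
  let ?S' = "{js \<in> ?S. insert i (set js) \<in> E}"
  let ?F = "{e. e \<in> E \<and> i \<in> e}"
  let ?h = "\<lambda>js. adj_tensor r (V, E) (i # js) * prod_list (map x js)"
  have finV: "finite V" and sub: "\<And>e. e \<in> E \<Longrightarrow> e \<subseteq> V \<and> card e = r"
    using unif by (auto simp: uniform_pair)
  have finS: "finite ?S"
    using finite_lists_length_eq[OF finV, of "r - 1"] by (simp add: conj_commute)
  have "sum ?h ?S = sum ?h ?S'"
    using finS by (intro sum.mono_neutral_right) (auto simp: adj_tensor_def)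
  also have "\<dots> = (\<Sum>e\<in>?F. sum ?h {js \<in> ?S'. insert i (set js) = e})"
    by (rule sum.group[symmetric]) (use finite_subset[OF _ finS, of ?S'] uniform_finite_edges[OF unif] in auto)
  also have "\<dots> = (\<Sum>e\<in>?F. \<Prod>w\<in>e - {i}. x w)"
  proof (rule sum.cong[OF refl])
    fix e assume "e \<in> ?F"
    then have e: "e \<in> E" "i \<in> e" "e \<subseteq> V" "card e = r" "finite e"
      using sub finV by (auto intro: finite_subset)
    have card: "card (e - {i}) = r - 1"
      using e by simp
    have "js \<in> permutations_of_set (e - {i})" if js: "js \<in> ?S'" "insert i (set js) = e" for js
    proof -
      have len: "length js = r - 1"
        using js by simp
      \<comment> \<open>Otherwise \<open>r - 1\<close> list entries would have to cover all
        \<open>r\<close> vertices of \<open>e\<close>.\<close>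
      have "i \<notin> set js"
      proof
        assume "i \<in> set js"
        then have "card e \<le> length js"
          using js(2) card_length[of js] by (simp add: insert_absorb)
        then show False
          using len e(4) \<open>r > 0\<close> by simp
      qed
      then have "set js = e - {i}"
        using js(2) by auto
      moreover from this have "distinct js"
        using len card by (intro card_distinct) simp
      ultimately show ?thesis
        by (simp add: permutations_of_set_def)
    qed
    moreover have "js \<in> ?S' \<and> insert i (set js) = e" if "js \<in> permutations_of_set (e - {i})" for js
      using that e card distinct_card[of js] by (auto simp: permutations_of_set_def insert_absorb)
    ultimately have eq: "{js \<in> ?S'. insert i (set js) = e} = permutations_of_set (e - {i})"
      by blast
    have "?h js = 1 / of_nat (fact (r - 1)) * (\<Prod>w\<in>e - {i}. x w)"
      if "js \<in> permutations_of_set (e - {i})" for js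
    proof -
      have js: "set js = e - {i}" "distinct js"
        using that by (auto simp: permutations_of_set_def)
      have "length (i # js) = r"
        using distinct_card[OF js(2)] js(1) card \<open>r > 0\<close> by simp
      moreover have "set (i # js) \<in> E"
        using js(1) e by (simp add: insert_absorb)
      ultimately show ?thesis
        using prod.distinct_set_conv_list[OF js(2), of x] js(1) by (simp add: adj_tensor_def)
    qed
    then have "sum ?h {js \<in> ?S'. insert i (set js) = e} =
        of_nat (card (permutations_of_set (e - {i}))) *
        (1 / of_nat (fact (r - 1)) * (\<Prod>w\<in>e - {i}. x w))"
      unfolding eq by simp
    also have "\<dots> = (\<Prod>w\<in>e - {i}. x w)"
      using e(5) card by simp
    finally show "sum ?h {js \<in> ?S'. insert i (set js) = e} = (\<Prod>w\<in>e - {i}. x w)" .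
  qed
  finally show ?thesis .
qed

text \<open>Compare an arbitrary eigenvector \<open>y\<close> with the positive one at a vertex maximising
  \<open>cmod (y i) / x i\<close>.\<close>

lemma tensor_eigenvalue_bound:
  fixes x :: "'a \<Rightarrow> real"
  assumes unif: "uniform r (V, E)" and r: "r > 0"
    and xpos: "\<And>i. i \<in> V \<Longrightarrow> x i > 0"
    and eig: "\<And>i. i \<in> V \<Longrightarrow> (\<Sum>e | e \<in> E \<and> i \<in> e. \<Prod>w\<in>e - {i}. x w) = t * x i ^ (r - 1)"
    and lam: "tensor_eigenvalue r (V, E) lam"
  shows "cmod lam \<le> t"
proof -
  have finV: "finite V" and sub: "\<And>e. e \<in> E \<Longrightarrow> e \<subseteq> V \<and> card e = r"
    using unif by (auto simp: uniform_pair)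
  obtain y where y0: "\<exists>i\<in>V. y i \<noteq> 0"
    and y: "\<And>i. i \<in> V \<Longrightarrow> (\<Sum>e | e \<in> E \<and> i \<in> e. \<Prod>w\<in>e - {i}. y w) = lam * y i ^ (r - 1)"
    using lam unfolding tensor_eigenvalue_def verts_pair adj_tensor_sum[OF unif r] by blast
  let ?q = "\<lambda>i. cmod (y i) / x i"
  define c where "c = Max (?q ` V)"
  have "c \<in> ?q ` V"
    unfolding c_def using finV y0 by (intro Max_in) auto
  then obtain i where i: "i \<in> V" "c = ?q i"
    by auto
  have cmax: "cmod (y j) \<le> c * x j" if "j \<in> V" for j
  proof -
    have "?q j \<le> c"
      unfolding c_def using finV that by (intro Max_ge) auto
    then show ?thesis
      using xpos[OF that] by (simp add: divide_le_eq)
  qed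
  obtain j where j: "j \<in> V" "y j \<noteq> 0"
    using y0 by blast
  have "0 < cmod (y j)"
    using j by simp
  also have "\<dots> \<le> c * x j"
    using cmax[OF j(1)] .
  \<comment> \<open>Positivity of \<open>c\<close> allows \<open>(c * x i) ^ (r - 1)\<close> to be
    cancelled at the end.\<close>
  finally have cpos: "c > 0"
    using xpos[OF j(1)] by (simp add: zero_less_mult_iff)
  have yi: "cmod (y i) = c * x i"
    using i xpos[OF i(1)] by simp
  have "cmod lam * (c * x i) ^ (r - 1) = cmod (\<Sum>e | e \<in> E \<and> i \<in> e. \<Prod>w\<in>e - {i}. y w)"
    using y[OF i(1)] yi by (simp add: norm_mult norm_power)
  also have "\<dots> \<le> (\<Sum>e | e \<in> E \<and> i \<in> e. \<Prod>w\<in>e - {i}. c * x w)"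
  proof (rule sum_norm_le)
    fix e assume "e \<in> {e. e \<in> E \<and> i \<in> e}"
    then show "cmod (\<Prod>w\<in>e - {i}. y w) \<le> (\<Prod>w\<in>e - {i}. c * x w)"
      unfolding prod_norm[symmetric] using cmax sub by (intro prod_mono) auto
  qed
  also have "\<dots> = (\<Sum>e | e \<in> E \<and> i \<in> e. c ^ (r - 1) * (\<Prod>w\<in>e - {i}. x w))"
  proof (rule sum.cong[OF refl])
    fix e assume "e \<in> {e. e \<in> E \<and> i \<in> e}"
    then have "card (e - {i}) = r - 1"
      using sub[of e] by simp
    then show "(\<Prod>w\<in>e - {i}. c * x w) = c ^ (r - 1) * (\<Prod>w\<in>e - {i}. x w)"
      by (simp add: prod.distrib)
  qed
  also have "\<dots> = t * (c * x i) ^ (r - 1)"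
    using eig[OF i(1)] by (simp add: sum_distrib_left[symmetric] power_mult_distrib)
  finally show ?thesis
    using cpos xpos[OF i(1)] by simp
qed

text \<open>The positive vector \<open>x\<close> makes \<open>t\<close> an eigenvalue and
  \<open>tensor_eigenvalue_bound\<close> bounds all moduli by \<open>t\<close>, so the supremum is
  attained there.\<close>

theorem spectral_radius_eq_largest_root:
  assumes T: "hypertree r (V, E)" and r: "r \<ge> 2" and "V \<noteq> {}"
  shows "spectral_radius_hg r (V, E) = Max {t. poly (matching_poly r (V, E)) t = 0}"
proof -
  have unif: "uniform r (V, E)"
    using T by (simp add: hypertree_def)
  have sub: "\<And>e. e \<in> E \<Longrightarrow> e \<subseteq> V \<and> card e = r \<and> finite e"
    using unif by (auto simp: uniform_pair intro: finite_subset)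
  obtain t where root: "poly (matching_poly r (V, E)) t = 0"
    and largest: "\<And>s. poly (matching_poly r (V, E)) s = 0 \<Longrightarrow> s \<le> t"
    and nonneg: "\<And>U. U \<subseteq> V \<Longrightarrow> poly (matching_poly r (induced E U)) t \<ge> 0"
    using ex_dominant_root[OF unif r \<open>V \<noteq> {}\<close>] by blast
  define q where "q = (\<lambda>w. poly (matching_poly r (induced E (V - {w}))) t)"
  have qpos: "q w > 0" if "w \<in> V" for w
    unfolding q_def using hypertree_vertex_removed_pos[OF T r that nonneg] .
  define x where "x = (\<lambda>w. root r (q w))"
  have xpos: "x w > 0" if "w \<in> V" for w
    using qpos[OF that] r by (simp add: x_def)
  have xr: "x w ^ r = q w" if "w \<in> V" for w
    using qpos[OF that] r by (simp add: x_def real_root_pow_pos2 less_imp_le)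
  have edge: "(\<Prod>w\<in>e. x w) = poly (matching_poly r (induced E (V - e))) t" if e: "e \<in> E" for e
  proof -
    obtain f where f: "edge_retraction (V, E) e f"
      using T e unfolding hypertree_def edges_pair by blast
    define W where "W = (\<lambda>w. {x \<in> V. f x = w})"
    define A where "A = (\<lambda>w. poly (matching_poly r (induced E (W w))) t)"
    define B where "B = (\<lambda>w. poly (matching_poly r (induced E (W w - {w}))) t)"
    note dec = matching_poly_edge_decomposition[OF unif e f r]
    have P: "(\<Prod>w\<in>e. A w) = (\<Prod>w\<in>e. B w)"
      using root unfolding dec(1) by (simp add: A_def B_def W_def poly_prod)
    have q: "q p = B p * (\<Prod>w\<in>e - {p}. A w)" if "p \<in> e" for p
      unfolding q_def dec(3)[OF that] by (simp add: A_def B_def W_def poly_prod)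
    have "B w \<noteq> 0" if "w \<in> e" for w
      using q[OF that] qpos[of w] sub[OF e] that by auto
    then have "(\<Prod>w\<in>e. A w) \<noteq> 0"
      unfolding P using sub[OF e] by simp
    then have A0: "A w \<noteq> 0" if "w \<in> e" for w
      using that sub[OF e] by auto
    \<comment> \<open>In this form the quotients multiply to \<open>1\<close> over \<open>e\<close>,
      since both products agree at the root \<open>t\<close>; what remains is the
      \<open>r\<close>-th power of the product of the \<open>B w\<close>.\<close>
    have q': "q p = B p / A p * (\<Prod>w\<in>e. B w)" if "p \<in> e" for p
      using q[OF that] prod.remove[of e p A] sub[OF e] that A0[OF that] P by (simp add: field_simps)
    have "(\<Prod>w\<in>e. x w) ^ r = (\<Prod>w\<in>e. x w ^ r)"
      by (rule prod_power_distrib)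
    also have "\<dots> = (\<Prod>w\<in>e. B w / A w * (\<Prod>w\<in>e. B w))"
      using sub[OF e] xr q' by (intro prod.cong) auto
    also have "\<dots> = (\<Prod>w\<in>e. B w) / (\<Prod>w\<in>e. A w) * (\<Prod>w\<in>e. B w) ^ r"
      using sub[OF e] by (simp add: prod.distrib prod_dividef)
    also have "\<dots> = (\<Prod>w\<in>e. B w) ^ r"
      using P \<open>(\<Prod>w\<in>e. A w) \<noteq> 0\<close> by simp
    finally have "(\<Prod>w\<in>e. x w) ^ r = (\<Prod>w\<in>e. B w) ^ r" .
    moreover have "(\<Prod>w\<in>e. B w) = poly (matching_poly r (induced E (V - e))) t"
      unfolding dec(2) by (simp add: A_def B_def W_def poly_prod)
    moreover have "0 \<le> (\<Prod>w\<in>e. x w)"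
      using xpos sub[OF e] by (intro prod_nonneg) (auto intro: less_imp_le)
    ultimately show ?thesis
      using nonneg[of "V - e"] r by (metis Diff_subset power_eq_imp_eq_base zero_less_numeral order.strict_trans2)
  qed
  have eig: "(\<Sum>e | e \<in> E \<and> i \<in> e. \<Prod>w\<in>e - {i}. x w) = t * x i ^ (r - 1)" if i: "i \<in> V" for i
  proof -
    \<comment> \<open>This is the vertex recursion at \<open>i\<close>, evaluated where the
      polynomial of the whole hypergraph vanishes.\<close>
    have "t * x i ^ r = (\<Sum>e | e \<in> E \<and> i \<in> e. poly (matching_poly r (induced E (V - e))) t)"
      using root matching_poly_vertex_recursion[OF unif i] r xr[OF i] by (simp add: poly_sum q_def)
    also have "\<dots> = (\<Sum>e | e \<in> E \<and> i \<in> e. x i * (\<Prod>w\<in>e - {i}. x w))"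
    proof (rule sum.cong[OF refl])
      fix e assume "e \<in> {e. e \<in> E \<and> i \<in> e}"
      then show "poly (matching_poly r (induced E (V - e))) t = x i * (\<Prod>w\<in>e - {i}. x w)"
        using edge[of e] sub[of e] prod.remove[of e i x] by simp
    qed
    also have "\<dots> = x i * (\<Sum>e | e \<in> E \<and> i \<in> e. \<Prod>w\<in>e - {i}. x w)"
      by (simp add: sum_distrib_left)
    finally have "x i * (t * x i ^ (r - 1)) = x i * (\<Sum>e | e \<in> E \<and> i \<in> e. \<Prod>w\<in>e - {i}. x w)"
      using r by (cases r) (auto simp: mult_ac)
    then show ?thesis
      using xpos[OF i] by simp
  qed
  obtain v where v: "v \<in> V"
    using \<open>V \<noteq> {}\<close> by auto
  have "0 \<le> (\<Sum>e | e \<in> E \<and> v \<in> e. \<Prod>w\<in>e - {v}. x w)"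
    using subsetD[OF conjunct1[OF sub]] by (intro sum_nonneg prod_nonneg) (auto intro!: less_imp_le xpos)
  \<comment> \<open>Needed to identify \<open>t\<close> with the modulus of the complex eigenvalue
    \<open>of_real t\<close>.\<close>
  then have t0: "t \<ge> 0"
    using eig[OF v] zero_less_power[OF xpos[OF v], of "r - 1"] by (simp add: zero_le_mult_iff)
  have "tensor_eigenvalue r (V, E) (of_real t)"
    unfolding tensor_eigenvalue_def verts_pair
  proof (intro exI[of _ "\<lambda>w. of_real (x w)"] conjI ballI)
    show "\<exists>i\<in>V. complex_of_real (x i) \<noteq> 0"
      using v xpos[OF v] by (intro bexI[of _ v]) auto
    fix i assume "i \<in> V"
    then show "(\<Sum>js\<in>{js. length js = r - 1 \<and> set js \<subseteq> V}.
        adj_tensor r (V, E) (i # js) * prod_list (map (\<lambda>w. complex_of_real (x w)) js)) =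
        complex_of_real t * complex_of_real (x i) ^ (r - 1)"
      using r arg_cong[OF eig, of i complex_of_real]
        adj_tensor_sum[OF unif, of i "\<lambda>w. complex_of_real (x w)"] by simp
  qed
  then have "t \<in> cmod ` {lam. tensor_eigenvalue r (V, E) lam}"
    using t0 by (intro image_eqI[of _ _ "of_real t"]) auto
  then have "spectral_radius_hg r (V, E) = t"
    unfolding spectral_radius_hg_def
  proof (rule cSup_eq_maximum)
    fix s assume "s \<in> cmod ` {lam. tensor_eigenvalue r (V, E) lam}"
    then show "s \<le> t"
      using tensor_eigenvalue_bound[OF unif _ xpos eig] r by auto
  qed
  also have "\<dots> = Max {t. poly (matching_poly r (V, E)) t = 0}"
  proof (rule Max_eqI[symmetric])
    show "finite {t. poly (matching_poly r (V, E)) t = 0}"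
      using matching_poly_monic[OF unif] r by (intro poly_roots_finite) auto
  qed (use root largest in auto)
  finally show ?thesis .
qed

section \<open>Coalescence\<close>

text \<open>Apply the vertex recursion at \<open>c\<close>: every edge through \<open>c\<close>
  belongs to one side, and the other side then enters with \<open>c\<close> removed.\<close>

lemma matching_poly_glue:
  assumes U1: "uniform r (V1, E1)" and U2: "uniform r (V2, E2)"
    and c: "V1 \<inter> V2 = {c}" and r: "r \<ge> 2"
  defines "P1 \<equiv> matching_poly r (induced E1 (V1 - {c}))"
    and "P2 \<equiv> matching_poly r (induced E2 (V2 - {c}))"
  shows matching_poly_glue_removed:
      "matching_poly r (induced (E1 \<union> E2) (V1 \<union> V2 - {c})) = P1 * P2"
    and matching_poly_glue_eq: "matching_poly r (V1 \<union> V2, E1 \<union> E2) =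
      matching_poly r (V1, E1) * P2 + P1 * matching_poly r (V2, E2) - [:0, 1:] * P1 * P2"
proof -
  have cV: "c \<in> V1" "c \<in> V2"
    using c by auto
  have sub1: "e \<subseteq> V1" if "e \<in> E1" for e
    using U1 that by (auto simp: uniform_pair)
  have sub2: "e \<subseteq> V2" "card e = r" if "e \<in> E2" for e
    using U2 that by (auto simp: uniform_pair)
  have fin: "finite E1" "finite E2"
    using U1 U2 by (auto dest: uniform_finite_edges)
  \<comment> \<open>A common edge would lie within \<open>{c}\<close>, too small for
    \<open>r >= 2\<close>.\<close>
  have dis: "E1 \<inter> E2 = {}"
  proof (rule ccontr)
    assume "E1 \<inter> E2 \<noteq> {}"
    then obtain e where "e \<in> E1" "e \<in> E2"
      by auto
    then have "e \<subseteq> {c}" "card e = r"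
      using sub1[of e] sub2[of e] c by auto
    then show False
      using card_mono[of "{c}" e] r by simp
  qed
  have split: "matching_poly r (induced (E1 \<union> E2) (W1 \<union> W2)) =
      matching_poly r (induced E1 W1) * matching_poly r (induced E2 W2)"
    if W: "W1 \<subseteq> V1 - {c}" "W2 \<subseteq> V2 - {c}" for W1 W2
  proof -
    have W12: "W1 \<inter> V2 = {}" "W2 \<inter> V1 = {}"
      using W c by auto
    have "e \<subseteq> W1" if "e \<in> E1" "e \<subseteq> W1 \<union> W2" for e
      using sub1[OF that(1)] that(2) W12 by auto
    moreover have "e \<subseteq> W2" if "e \<in> E2" "e \<subseteq> W1 \<union> W2" for e
      using sub2(1)[OF that(1)] that(2) W12 by auto
    ultimately have "{e \<in> E1 \<union> E2. e \<subseteq> W1 \<union> W2} = {e \<in> E1. e \<subseteq> W1} \<union> {e \<in> E2. e \<subseteq> W2}"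
      by blast
    moreover have "matching_poly r (W1 \<union> W2, {e \<in> E1. e \<subseteq> W1} \<union> {e \<in> E2. e \<subseteq> W2}) =
        matching_poly r (W1, {e \<in> E1. e \<subseteq> W1}) * matching_poly r (W2, {e \<in> E2. e \<subseteq> W2})"
    proof (rule matching_poly_disjoint_Un)
      show "uniform r (W1, {e \<in> E1. e \<subseteq> W1})"
        using uniform_induced[OF U1, of W1] W by (auto simp: induced_def)
      show "uniform r (W2, {e \<in> E2. e \<subseteq> W2})"
        using uniform_induced[OF U2, of W2] W by (auto simp: induced_def)
    qed (use W W12 r in auto)
    ultimately show ?thesis
      by (simp add: induced_def)
  qed
  have "V1 \<union> V2 - {c} = (V1 - {c}) \<union> (V2 - {c})"
    by auto
  then show removed: "matching_poly r (induced (E1 \<union> E2) (V1 \<union> V2 - {c})) = P1 * P2"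
    using split[of "V1 - {c}" "V2 - {c}"] by (simp add: P1_def P2_def)
  let ?S1 = "\<Sum>e | e \<in> E1 \<and> c \<in> e. matching_poly r (induced E1 (V1 - e))"
  let ?S2 = "\<Sum>e | e \<in> E2 \<and> c \<in> e. matching_poly r (induced E2 (V2 - e))"
  let ?h = "\<lambda>e. matching_poly r (induced (E1 \<union> E2) (V1 \<union> V2 - e))"
  have "(\<Sum>e | e \<in> E1 \<union> E2 \<and> c \<in> e. ?h e) =
      sum ?h ({e. e \<in> E1 \<and> c \<in> e} \<union> {e. e \<in> E2 \<and> c \<in> e})"
    by (rule sum.cong) auto
  also have "\<dots> = (\<Sum>e | e \<in> E1 \<and> c \<in> e. ?h e) + (\<Sum>e | e \<in> E2 \<and> c \<in> e. ?h e)"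
    using fin dis by (intro sum.union_disjoint) auto
  also have "(\<Sum>e | e \<in> E1 \<and> c \<in> e. ?h e) = ?S1 * P2"
    unfolding sum_distrib_right
  proof (rule sum.cong[OF refl])
    fix e assume "e \<in> {e. e \<in> E1 \<and> c \<in> e}"
    then have "c \<in> e" "V1 \<union> V2 - e = (V1 - e) \<union> (V2 - {c})"
      using sub1[of e] c by auto
    then show "?h e = matching_poly r (induced E1 (V1 - e)) * P2"
      using split[of "V1 - e" "V2 - {c}"] by (auto simp: P2_def)
  qed
  also have "(\<Sum>e | e \<in> E2 \<and> c \<in> e. ?h e) = P1 * ?S2"
    unfolding sum_distrib_left
  proof (rule sum.cong[OF refl])
    fix e assume "e \<in> {e. e \<in> E2 \<and> c \<in> e}"
    then have "c \<in> e" "V1 \<union> V2 - e = (V1 - {c}) \<union> (V2 - e)"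
      using sub2[of e] c by auto
    then show "?h e = P1 * matching_poly r (induced E2 (V2 - e))"
      using split[of "V1 - {c}" "V2 - e"] by (auto simp: P1_def)
  qed
  finally have sum: "(\<Sum>e | e \<in> E1 \<union> E2 \<and> c \<in> e. ?h e) = ?S1 * P2 + P1 * ?S2" .
  have "matching_poly r (V1 \<union> V2, E1 \<union> E2) = [:0, 1:] * (P1 * P2) - (?S1 * P2 + P1 * ?S2)"
    using matching_poly_vertex_recursion[of r "V1 \<union> V2" "E1 \<union> E2" c] U1 U2 cV r removed sum
    by (auto simp: uniform_pair)
  moreover have "matching_poly r (V1, E1) = [:0, 1:] * P1 - ?S1"
    using matching_poly_vertex_recursion[OF U1 cV(1)] r by (simp add: P1_def)
  moreover have "matching_poly r (V2, E2) = [:0, 1:] * P2 - ?S2"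
    using matching_poly_vertex_recursion[OF U2 cV(2)] r by (simp add: P2_def)
  \<comment> \<open>The two one-sided recursions together count \<open>X * P1 * P2\<close> twice,
    hence the correction term.\<close>
  moreover have ring: "X * (P1 * P2) - (s1 * P2 + P1 * s2) =
      (X * P1 - s1) * P2 + P1 * (X * P2 - s2) - X * P1 * P2" for X s1 s2
    by (simp add: algebra_simps)
  ultimately show "matching_poly r (V1 \<union> V2, E1 \<union> E2) =
      matching_poly r (V1, E1) * P2 + P1 * matching_poly r (V2, E2) - [:0, 1:] * P1 * P2"
    by (simp only: ring)
qed

lemma matching_poly_delete_vertex_image:
  assumes unif: "uniform r (V, E)" and g: "inj_on g V" and "v \<in> V" and "r > 0"
  shows "matching_poly r (induced ((`) g ` E) (g ` V - {g v})) = matching_poly r (induced E (V - {v}))"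
proof -
  have V: "g ` V - {g v} = g ` (V - {v})"
    using g \<open>v \<in> V\<close> by (auto simp: inj_on_def)
  have "g ` e \<subseteq> g ` (V - {v}) \<longleftrightarrow> e \<subseteq> V - {v}" if "e \<in> E" for e
  proof -
    have "e \<subseteq> V"
      using unif that by (auto simp: uniform_pair)
    then show ?thesis
      unfolding V[symmetric] using inj_on_image_mem_iff[OF g \<open>v \<in> V\<close>, of e]
      by (simp add: subset_Diff_insert image_mono)
  qed
  then have "{e \<in> (`) g ` E. e \<subseteq> g ` (V - {v})} = (`) g ` {e \<in> E. e \<subseteq> V - {v}}"
    by auto
  then show ?thesis
    unfolding V induced_def
    using matching_poly_image[of g "V - {v}" r "{e \<in> E. e \<subseteq> V - {v}}"]
      uniform_induced[OF unif, of "V - {v}"] inj_on_subset[OF g, of "V - {v}"] \<open>r > 0\<close>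
    by (simp add: induced_def)
qed

text \<open>The formulas are those of \<open>n\<close> rooted hypergraphs, each with matching polynomials \<open>A\<close>, and \<open>B\<close>
  after removing the root, that are glued together at their roots.\<close>

definition bouquet :: "nat \<Rightarrow> real poly \<Rightarrow> real poly \<Rightarrow> nat \<Rightarrow> 'a \<Rightarrow> 'a hypergraph \<Rightarrow> bool" where
  "bouquet r A B n c K \<longleftrightarrow> hypertree r K \<and> c \<in> verts K \<and>
    matching_poly r (delete_vertex K c) = B ^ n \<and>
    matching_poly r K = [:0, 1:] * B ^ n + of_nat n * (A - [:0, 1:] * B) * B ^ (n - 1)"

text \<open>By the vertex recursion \<open>A - x B\<close> is the contribution of the edges at the
  root of one copy; a further copy adds one such term and multiplies everything else by
  \<open>B\<close>.\<close>

lemma bouquet_glue: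
  assumes K: "bouquet r A B n c (W, F)" and T: "hypertree r (V, E)" and v: "v \<in> V"
    and A: "matching_poly r (V, E) = A" and B: "matching_poly r (delete_vertex (V, E) v) = B"
    and g: "inj_on g V" "g v = c" "W \<inter> g ` V = {c}" and r: "r \<ge> 2"
  shows "bouquet r A B (Suc n) c (W \<union> g ` V, F \<union> (`) g ` E)"
proof -
  have WF: "hypertree r (W, F)" "uniform r (W, F)" "c \<in> W"
    and unif: "uniform r (V, E)"
    using K T by (auto simp: bouquet_def hypertree_def)
  have unif_g: "uniform r (g ` V, (`) g ` E)"
    using unif g(1) by (rule uniform_image)
  have tree: "hypertree r (W \<union> g ` V, F \<union> (`) g ` E)"
    using WF(1) hypertree_image[OF T g(1)] g(3) by (rule hypertree_glue)
  then have unif_K: "uniform r (W \<union> g ` V, F \<union> (`) g ` E)"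
    by (simp add: hypertree_def)
  have W': "matching_poly r (induced F (W - {c})) = B ^ n"
    using K delete_vertex_eq_induced[OF WF(2), of c] by (simp add: bouquet_def)
  have B': "matching_poly r (induced ((`) g ` E) (g ` V - {c})) = B"
    using matching_poly_delete_vertex_image[OF unif g(1) v] delete_vertex_eq_induced[OF unif] B g(2) r
    by simp
  have A': "matching_poly r (g ` V, (`) g ` E) = A"
    using matching_poly_image[OF g(1) unif] A r by simp
  have "matching_poly r (delete_vertex (W \<union> g ` V, F \<union> (`) g ` E) c) = B ^ Suc n"
    using matching_poly_glue(1)[OF WF(2) unif_g g(3) r] W' B'
    by (simp add: delete_vertex_eq_induced[OF unif_K] mult.commute)
  moreover have "matching_poly r (W \<union> g ` V, F \<union> (`) g ` E) =
      [:0, 1:] * B ^ Suc n + of_nat (Suc n) * (A - [:0, 1:] * B) * B ^ (Suc n - 1)"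
  proof -
    have "matching_poly r (W \<union> g ` V, F \<union> (`) g ` E) =
        ([:0, 1:] * B ^ n + of_nat n * (A - [:0, 1:] * B) * B ^ (n - 1)) * B + B ^ n * A -
        [:0, 1:] * B ^ n * B"
      using matching_poly_glue(2)[OF WF(2) unif_g g(3) r] W' B' A' K by (simp add: bouquet_def)
    \<comment> \<open>The case \<open>n = 0\<close> is separate because the exponent
      \<open>n - 1\<close> is truncated there.\<close>
    also have "\<dots> = [:0, 1:] * B ^ Suc n + of_nat (Suc n) * (A - [:0, 1:] * B) * B ^ (Suc n - 1)"
    proof (cases n)
      case (Suc k)
      define X where "X = ([:0, 1:] :: real poly)"
      show ?thesis
        unfolding Suc X_def[symmetric] by (simp add: algebra_simps del: of_nat_Suc) (simp add: algebra_simps)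
    qed (simp add: algebra_simps)
    finally show ?thesis .
  qed
  ultimately show ?thesis
    using tree WF(3) by (simp add: bouquet_def)
qed

section \<open>Building the coalescence copy by copy\<close>

lemma coalesce_0_0: "coalesce H v 0 G u 0 = ({None}, {})"
  by (simp add: coalesce_def)

text \<open>Presents the new copy as the image of \<open>(V, E)\<close> under a map taking the root
  to \<open>None\<close>, as \<open>bouquet_glue\<close> requires.\<close>

lemma coalesce_Suc_left:
  assumes "v \<in> V"
  shows "coalesce (V, E) v (Suc a) G u b =
    (verts (coalesce (V, E) v a G u b) \<union> (\<lambda>w. if w = v then None else Some (Inl (a, w))) ` V,
     edges (coalesce (V, E) v a G u b) \<union> (`) (\<lambda>w. if w = v then None else Some (Inl (a, w))) ` E)"
  unfolding coalesce_def verts_pair edges_pair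
proof (intro arg_cong2[of _ _ _ _ Pair], goal_cases)
  case 1
  show ?case
    using assms by (auto simp: less_Suc_eq image_iff)
next
  case 2
  show ?case
    unfolding less_Suc_eq by blast
qed

lemma coalesce_Suc_right:
  assumes "u \<in> V"
  shows "coalesce H v a (V, E) u (Suc b) =
    (verts (coalesce H v a (V, E) u b) \<union> (\<lambda>w. if w = u then None else Some (Inr (b, w))) ` V,
     edges (coalesce H v a (V, E) u b) \<union> (`) (\<lambda>w. if w = u then None else Some (Inr (b, w))) ` E)"
  unfolding coalesce_def verts_pair edges_pair
proof (intro arg_cong2[of _ _ _ _ Pair], goal_cases)
  case 1
  show ?case
    using assms by (auto simp: less_Suc_eq image_iff)
next
  case 2
  show ?case
    unfolding less_Suc_eq by blast
qed

text \<open>Both kinds of copies share \<open>A\<close> and \<open>B\<close>, so attaching either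
  has the same effect and only \<open>a + b\<close> matters. Starting from the lone vertex
  \<open>None\<close>, the \<open>b\<close> copies are attached first, then the \<open>a\<close>
  copies.\<close>

lemma bouquet_coalesce:
  assumes H: "hypertree r (V, E)" "v \<in> V" "matching_poly r (V, E) = A"
      "matching_poly r (delete_vertex (V, E) v) = B"
    and G: "hypertree r (V', E')" "u \<in> V'" "matching_poly r (V', E') = A"
      "matching_poly r (delete_vertex (V', E') u) = B"
    and r: "r \<ge> 2"
  shows "bouquet r A B (a + b) None (coalesce (V, E) v a (V', E') u b)"
proof (induction a)
  case 0
  show ?case
  proof (induction b)
    case 0
    show ?case
      unfolding coalesce_0_0
      by (auto simp: bouquet_def hypertree_def uniform_pair cut_connected_def delete_vertex_def
          matching_poly_empty_edges monom_altdef)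
  next
    case (Suc b)
    let ?K = "coalesce (V, E) v 0 (V', E') u b"
    have "bouquet r A B (Suc (0 + b)) None (coalesce (V, E) v 0 (V', E') u (Suc b))"
      unfolding coalesce_Suc_right[OF G(2)]
    proof (rule bouquet_glue[OF _ G _ _ _ r])
      show "bouquet r A B (0 + b) None (verts ?K, edges ?K)"
        using Suc by (simp add: verts_def edges_def)
    qed (use G(2) in \<open>auto simp: inj_on_def coalesce_def image_iff split: if_splits\<close>)
    then show ?case
      by simp
  qed
next
  case (Suc a)
  let ?K = "coalesce (V, E) v a (V', E') u b"
  have "bouquet r A B (Suc (a + b)) None (coalesce (V, E) v (Suc a) (V', E') u b)"
    unfolding coalesce_Suc_left[OF H(2)]
  proof (rule bouquet_glue[OF _ H _ _ _ r])
    show "bouquet r A B (a + b) None (verts ?K, edges ?K)"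
      using Suc by (simp add: verts_def edges_def)
  qed (use H(2) in \<open>auto simp: inj_on_def coalesce_def image_iff split: if_splits\<close>)
  then show ?case
    by simp
qed

theorem theorem2:
  fixes r m :: nat and G :: "'a hypergraph" and H :: "'b hypergraph" and u :: 'a and v :: 'b
  assumes "r \<ge> 3"
    and "supertree r G" and "supertree r H"
    and "card (verts G) = card (verts H)"
    and "u \<in> verts G" and "v \<in> verts H"
    and "m > 0"
    and "matching_poly r G = matching_poly r H"
    and "matching_poly r (delete_vertex G u) = matching_poly r (delete_vertex H v)"
  shows "(\<forall>k\<le>m. spectral_radius_hg r (coalesce H v (m - k) G u k)
                 = spectral_radius_hg r (coalesce H v m G u 0))
       \<and> (\<forall>k\<le>m. matching_energy r (coalesce H v (m - k) G u k)
                 = matching_energy r (coalesce H v m G u 0))"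
proof -
  obtain V E V' E' where HG: "H = (V, E)" "G = (V', E')"
    by (metis surj_pair)
  have trees: "hypertree r (V, E)" "hypertree r (V', E')"
    using assms(1-3) supertree_hypertree[of r V E] supertree_hypertree[of r V' E'] unfolding HG by auto
  let ?K = "\<lambda>a b. coalesce H v a G u b"
  have K: "bouquet r (matching_poly r H) (matching_poly r (delete_vertex H v)) (a + b) None (?K a b)" for a b
    using assms trees unfolding HG by (intro bouquet_coalesce) auto
  \<comment> \<open>The total number of copies is \<open>m\<close> on both sides, as
    \<open>k\<close> is at most \<open>m\<close>.\<close>
  have poly_eq: "matching_poly r (?K (m - k) k) = matching_poly r (?K m 0)" if "k \<le> m" for k
    using K[of "m - k" k] K[of m 0] that by (simp add: bouquet_def)
  have rho: "spectral_radius_hg r (?K a b) = Max {t. poly (matching_poly r (?K a b)) t = 0}" for a b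
  proof -
    obtain W F where WF: "?K a b = (W, F)"
      by (metis surj_pair)
    then have "hypertree r (W, F)" "None \<in> W"
      using K[of a b] by (auto simp: bouquet_def)
    then show ?thesis
      unfolding WF using assms(1) by (intro spectral_radius_eq_largest_root) auto
  qed
  show ?thesis
    using poly_eq by (auto simp: rho matching_energy_def)
qed

end
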